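(* Let $n\ge 1$ be an integer, let $1<p<\infty$ with $1/p+1/p'=1$, and let $0\le\alpha<n$. Then for every $g\in\mathcal{S}(\mathbb{R}^n)$, $$\big\|\,|x|^{-\alpha/p}g\big\|_{L^p(\mathbb{R}^n)}\le 2^{-\alpha/p}\left[\frac{\Gamma\big(\frac{n-\alpha}{2p}\big)\,\Gamma\big(\frac{n}{2p'}\big)}{\Gamma\big(\frac{n}{2p'}+\frac{\alpha}{2p}\big)\,\Gamma\big(\frac{n}{2p}\big)}\right]\big\|(-\Delta)^{\alpha/(2p)}g\big\|_{L^p(\mathbb{R}^n)}.$$
   Context: $\mathcal{S}(\mathbb{R}^n)$ is the Schwartz class. The Fourier transform is $\hat f(y)=\int_{\mathbb{R}^n}e^{2\pi i x\cdot y}f(x)\,dx$. $\Delta$ is the Laplacian on $\mathbb{R}^n$, and for $s\ge 0$ the operator $(-\Delta)^{s/2}$ is the Fourier multiplier operator with symbol $(2\pi|y|)^{s}$. $\Gamma$ is the Euler Gamma function. *)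

theory Defs
  imports "HOL-Analysis.Analysis"
begin

definition partial_deriv :: "'n::finite \<Rightarrow> (real^'n \<Rightarrow> complex) \<Rightarrow> real^'n \<Rightarrow> complex" where
  "partial_deriv i f x = vector_derivative (\<lambda>t. f (x + t *\<^sub>R axis i 1)) (at 0)"

(* A list of coordinates encodes an iterated partial derivative. Differentiability of all of
   them says that the function is infinitely differentiable. *)
definition schwartz_space :: "(real^'n::finite \<Rightarrow> complex) set" where
  "schwartz_space = {f. \<forall>js :: 'n list.
     foldr partial_deriv js f differentiable_on UNIV \<and>
     (\<forall>k :: 'n \<Rightarrow> nat.
        bounded (range (\<lambda>x. (\<Prod>i\<in>UNIV. (x $ i) ^ k i) *\<^sub>R foldr partial_deriv js f x)))}"

(* The sign in the exponent is positive, so the inverse transform carries the negative sign. *)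
definition fourier :: "(real^'n::finite \<Rightarrow> complex) \<Rightarrow> real^'n \<Rightarrow> complex" where
  "fourier f y = (LINT x|lborel. exp (2 * pi * \<i> * (x \<bullet> y)) * f x)"

definition inverse_fourier :: "(real^'n::finite \<Rightarrow> complex) \<Rightarrow> real^'n \<Rightarrow> complex" where
  "inverse_fourier h x = (LINT y|lborel. exp (- 2 * pi * \<i> * (x \<bullet> y)) * h y)"

definition fourier_multiplier ::
    "(real^'n::finite \<Rightarrow> complex) \<Rightarrow> (real^'n \<Rightarrow> complex) \<Rightarrow> real^'n \<Rightarrow> complex" where
  "fourier_multiplier m f = inverse_fourier (\<lambda>y. m y * fourier f y)"

(* frac_laplacian r is the operator with exponent r, whose symbol is (2 pi |y|)^(2 r).
   For r = 0 the value 0 powr 0 = 0 alters the symbol only at the origin, a null set. *)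
definition frac_laplacian :: "real \<Rightarrow> (real^'n::finite \<Rightarrow> complex) \<Rightarrow> real^'n \<Rightarrow> complex" where
  "frac_laplacian r = fourier_multiplier (\<lambda>y. complex_of_real ((2 * pi * norm y) powr (2 * r)))"

(* Extended-valued, so that a divergent integral gives an infinite norm. *)
definition Lp_norm :: "real \<Rightarrow> (real^'n::finite \<Rightarrow> complex) \<Rightarrow> ennreal" where
  "Lp_norm p f =
     (let I = (\<integral>\<^sup>+ x. ennreal (norm (f x) powr p) \<partial>lborel)
      in if I = top then top else ennreal (enn2real I powr (1 / p)))"

end

theory Submission
  imports Defs "HOL-Probability.Probability"
begin

text \<open>
  Put $s=\alpha/p$, so that $0\le s<n/p$, and $f=(-\Delta)^{s/2}g$. For $s>0$ the function $g$ is the Riesz potential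
  $(-\Delta)^{-s/2}f$, a convolution of $f$ with a multiple of $|x|^{s-n}$. The inequality therefore says that
  the integral operator with kernel a multiple of $|x|^{-s}|x-y|^{s-n}$ is bounded on $L^p$ with the stated constant.
  This kernel is positive and homogeneous of degree $-n$, and its norm is found by the Schur test
  (\<open>schur_test\<close>) with a power weight. The test needs the integrals
  $\int|x-y|^{a-n}|y|^{b-n}\,dy$, and these give precisely the quotient of Gamma functions
  (\<open>riesz_potential_of_power\<close>, \<open>riesz_const_quotients\<close>, \<open>stein_weiss_inequality\<close>).

  Heat kernels carry all the explicit computations. Subordination,
  \[ (-\Delta)^{-a/2}=\frac1{\Gamma(a/2)}\int_0^\infty t^{a/2-1}e^{t\Delta}\,dt , \]
  defines the Riesz kernel as a superposition of Gaussians. The law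
  $(-\Delta)^{-a/2}(-\Delta)^{-b/2}=(-\Delta)^{-(a+b)/2}$ is then the semigroup law of the heat kernel
  together with the Beta integral (\<open>riesz_kernel_convolution\<close>). The same formula yields
  $|g|\le(-\Delta)^{-s/2}|f|$ (\<open>norm_le_riesz_potential_frac_laplacian\<close>): in Fourier variables,
  $e^{t\Delta}$ is the multiplier $e^{-4\pi^2t|y|^2}$, and integrating it over $t$ cancels the symbol
  $(2\pi|y|)^s$, which leaves the inversion formula for $g$ (\<open>fourier_inversion\<close>). All that is needed about
  $g$ here is that $\hat g$ decreases rapidly, which follows by integrating by parts
  (\<open>fourier_rapidly_decreasing\<close>).

  For $s=0$ both sides agree, by Fourier inversion, and the constant is $1$.
\<close>

section \<open>Integration over Euclidean space\<close>

lemma lborel_integral_prod: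
  fixes f :: "'a::euclidean_space \<Rightarrow> real \<Rightarrow> 'b::{real_normed_field,banach,second_countable_topology}"
  assumes int: "\<And>b. b \<in> Basis \<Longrightarrow> integrable lborel (f b)"
  shows "(LINT x|lborel. (\<Prod>b\<in>Basis. f b (x \<bullet> b))) = (\<Prod>b\<in>Basis. LINT t|lborel. f b t)"
proof -
  interpret product_sigma_finite "\<lambda>_::'a. lborel :: real measure"
    by standard
  have [measurable]: "f b \<in> borel_measurable borel" if "b \<in> Basis" for b
    using int[OF that] by (simp add: integrable_iff_bounded)
  have "(LINT x|lborel. (\<Prod>b\<in>Basis. f b (x \<bullet> b)))
      = (LINT x|(\<Pi>\<^sub>M b\<in>Basis. lborel). (\<Prod>b\<in>Basis. f b (x b)))"
    by (subst lborel_eq, subst integral_distr) (auto intro!: Bochner_Integration.integral_cong)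
  also have "\<dots> = (\<Prod>b\<in>Basis. LINT t|lborel. f b t)"
    by (rule product_integral_prod) (auto intro: int)
  finally show ?thesis .
qed

lemma integrable_lborel_pairI:
  fixes f :: "'a::euclidean_space \<Rightarrow> 'b::euclidean_space \<Rightarrow> complex"
  assumes [measurable]: "case_prod f \<in> borel_measurable (borel \<Otimes>\<^sub>M borel)"
    and fin: "(\<integral>\<^sup>+x. (\<integral>\<^sup>+y. ennreal (norm (f x y)) \<partial>lborel) \<partial>lborel) < \<infinity>"
  shows "integrable (lborel \<Otimes>\<^sub>M lborel) (case_prod f)"
proof (rule integrableI_bounded)
  show "case_prod f \<in> borel_measurable (lborel \<Otimes>\<^sub>M lborel)" by measurable
  have "(\<integral>\<^sup>+z. ennreal (norm (case_prod f z)) \<partial>(lborel \<Otimes>\<^sub>M lborel))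
     = (\<integral>\<^sup>+x. (\<integral>\<^sup>+y. ennreal (norm (f x y)) \<partial>lborel) \<partial>lborel)"
    by (subst lborel.nn_integral_fst[symmetric]) simp_all
  with fin show "(\<integral>\<^sup>+z. ennreal (norm (case_prod f z)) \<partial>(lborel \<Otimes>\<^sub>M lborel)) < \<infinity>" by simp
qed

lemma Fubini_lborel:
  fixes f :: "'a::euclidean_space \<Rightarrow> 'b::euclidean_space \<Rightarrow> complex"
  assumes "case_prod f \<in> borel_measurable (borel \<Otimes>\<^sub>M borel)"
    and "(\<integral>\<^sup>+x. (\<integral>\<^sup>+y. ennreal (norm (f x y)) \<partial>lborel) \<partial>lborel) < \<infinity>"
  shows "(LINT x|lborel. LINT y|lborel. f x y) = (LINT y|lborel. LINT x|lborel. f x y)"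
  using lborel_pair.Fubini_integral[OF integrable_lborel_pairI[OF assms]] by simp

lemma nn_integral_lborel_translation:
  fixes f :: "'a::euclidean_space \<Rightarrow> ennreal"
  assumes [measurable]: "f \<in> borel_measurable borel"
  shows "(\<integral>\<^sup>+x. f (v + x) \<partial>lborel) = (\<integral>\<^sup>+x. f x \<partial>lborel)"
proof -
  have "(\<integral>\<^sup>+x. f x \<partial>lborel) = (\<integral>\<^sup>+x. f x \<partial>distr lborel borel ((+) v))"
    by (simp only: lborel_distr_plus)
  also have "\<dots> = (\<integral>\<^sup>+x. f (v + x) \<partial>lborel)"
    by (rule nn_integral_distr) auto
  finally show ?thesis ..
qed

lemma integral_lborel_affine:
  fixes f :: "'a::euclidean_space \<Rightarrow> complex"
  assumes [measurable]: "f \<in> borel_measurable borel" and c: "c \<noteq> 0"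
  shows "(LINT x|lborel. f x) = (LINT x|lborel. (\<bar>c\<bar> ^ DIM('a)) *\<^sub>R f (v + c *\<^sub>R x))"
proof -
  have "(LINT x|lborel. f x) = (LINT x|density (distr lborel borel (\<lambda>x. v + c *\<^sub>R x)) (\<lambda>_. ennreal (\<bar>c\<bar> ^ DIM('a))). f x)"
    using lborel_affine[OF c, of v] by simp
  also have "\<dots> = (LINT x|distr lborel borel (\<lambda>x. v + c *\<^sub>R x). (\<bar>c\<bar> ^ DIM('a)) *\<^sub>R f x)"
    by (rule integral_density) auto
  also have "\<dots> = (LINT x|lborel. (\<bar>c\<bar> ^ DIM('a)) *\<^sub>R f (v + c *\<^sub>R x))"
    by (rule integral_distr) auto
  finally show ?thesis .
qed

lemma ennreal_norm_integral_le:
  fixes f :: "'a \<Rightarrow> complex"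
  shows "ennreal (norm (integral\<^sup>L M f)) \<le> (\<integral>\<^sup>+x. ennreal (norm (f x)) \<partial>M)"
  \<comment> \<open>The Bochner integral of a non-integrable function is $0$.\<close>
  by (cases "integrable M f") (auto simp: integral_norm_bound_ennreal not_integrable_integral_eq)

lemma AE_lborel_nonzero: "AE x in lborel. (x :: 'a::euclidean_space) \<noteq> 0"
  by (rule AE_lborel_singleton)

section \<open>The heat kernel\<close>

text \<open>
  The Gauss--Weierstrass kernel of $e^{t\Delta}$ on a Euclidean space. Written as a product of
  normal densities of variance $2t$, it inherits its total mass, its semigroup law and its Fourier
  transform from the one-dimensional facts about normal distributions.
\<close>

definition heat_kernel :: "real \<Rightarrow> 'a::euclidean_space \<Rightarrow> real" where
  "heat_kernel t x = (\<Prod>b\<in>Basis. normal_density 0 (sqrt (2 * t)) (x \<bullet> b))"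

lemma heat_kernel_nonneg [simp]: "0 \<le> heat_kernel t x"
  unfolding heat_kernel_def by (intro prod_nonneg) auto

lemma norm_power2_eq_sum_Basis: "(norm x)\<^sup>2 = (\<Sum>b\<in>Basis. (x \<bullet> b)\<^sup>2)"
  for x :: "'a::euclidean_space"
  unfolding power2_norm_eq_inner by (subst euclidean_inner) (simp add: power2_eq_square)

lemma heat_kernel_eq:
  fixes x :: "'a::euclidean_space"
  assumes t: "0 < t"
  shows "heat_kernel t x = (4 * pi * t) powr (- real DIM('a) / 2) * exp (- (norm x)\<^sup>2 / (4 * t))"
proof -
  have "heat_kernel t x = (\<Prod>b\<in>(Basis::'a set). (4 * pi * t) powr (- 1 / 2) * exp (- (x \<bullet> b)\<^sup>2 / (4 * t)))"
    unfolding heat_kernel_def normal_density_def using t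
    by (intro prod.cong refl) (simp add: powr_minus powr_half_sqrt divide_simps)
  also have "\<dots> = (4 * pi * t) powr (- real DIM('a) / 2) * exp (\<Sum>b\<in>(Basis::'a set). - (x \<bullet> b)\<^sup>2 / (4 * t))"
    using t by (simp add: prod.distrib exp_sum powr_power)
  also have "(\<Sum>b\<in>(Basis::'a set). - (x \<bullet> b)\<^sup>2 / (4 * t)) = - (norm x)\<^sup>2 / (4 * t)"
    by (simp add: norm_power2_eq_sum_Basis sum_divide_distrib sum_negf)
  finally show ?thesis .
qed

lemma measurable_heat_kernel [measurable]:
  "(\<lambda>(t, x). heat_kernel t x) \<in> borel_measurable (borel \<Otimes>\<^sub>M borel)"
  unfolding heat_kernel_def normal_density_def by measurable

lemma heat_kernel_minus_commute: "heat_kernel t (x - y) = heat_kernel t (y - x)"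
  unfolding heat_kernel_def normal_density_def by (simp add: inner_diff_left power2_commute)

lemma nn_integral_heat_kernel:
  assumes t: "0 < t"
  shows "(\<integral>\<^sup>+x. ennreal (heat_kernel t (x::'a::euclidean_space)) \<partial>lborel) = 1"
proof -
  have "(\<integral>\<^sup>+x. ennreal (normal_density 0 (sqrt (2 * t)) x) \<partial>lborel) = 1"
    using t by (subst nn_integral_eq_integral) auto
  then show ?thesis
    unfolding heat_kernel_def
    by (subst prod_ennreal[symmetric])
       (simp_all add: nn_integral_lborel_prod[of "\<lambda>_ x. ennreal (normal_density 0 (sqrt (2 * t)) x)"])
qed

lemma heat_kernel_semigroup:
  fixes x :: "'a::euclidean_space"
  assumes t: "0 < t" and u: "0 < u"
  shows "(\<integral>\<^sup>+y. ennreal (heat_kernel t (x - y) * heat_kernel u y) \<partial>lborel) = ennreal (heat_kernel (t + u) x)"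
proof -
  have "(\<integral>\<^sup>+y. ennreal (heat_kernel t (x - y) * heat_kernel u y) \<partial>lborel)
     = (\<integral>\<^sup>+y. (\<Prod>b\<in>Basis. ennreal (normal_density 0 (sqrt (2 * t)) (x \<bullet> b - y \<bullet> b)
          * normal_density 0 (sqrt (2 * u)) (y \<bullet> b))) \<partial>lborel)"
    unfolding heat_kernel_def
    by (subst prod_ennreal) (simp_all add: inner_diff_left prod.distrib)
  also have "\<dots> = (\<Prod>b\<in>Basis. (\<integral>\<^sup>+s. ennreal (normal_density 0 (sqrt (2 * t)) (x \<bullet> b - s)
          * normal_density 0 (sqrt (2 * u)) s) \<partial>lborel))"
    by (rule nn_integral_lborel_prod) auto
  also have "\<dots> = (\<Prod>b\<in>Basis. ennreal (normal_density 0 (sqrt (2 * t + 2 * u)) (x \<bullet> b)))"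
    using t u fun_cong[OF conv_normal_density_zero_mean[of "sqrt (2 * t)" "sqrt (2 * u)"]]
    by simp
  also have "\<dots> = ennreal (heat_kernel (t + u) x)"
    unfolding heat_kernel_def by (simp add: prod_ennreal ring_distribs)
  finally show ?thesis .
qed

lemma integrable_heat_kernel:
  assumes t: "0 < t" shows "integrable lborel (heat_kernel t :: 'a::euclidean_space \<Rightarrow> real)"
  using nn_integral_heat_kernel[OF t, where 'a='a] by (intro integrableI_nonneg) auto

lemma normal_density_char:
  assumes s: "0 < \<sigma>"
  shows "(LINT x|lborel. exp (\<i> * of_real (\<tau> * x)) * of_real (normal_density 0 \<sigma> x))
     = exp (- of_real (\<sigma>\<^sup>2 * \<tau>\<^sup>2 / 2))"
proof -
  have "(LINT x|lborel. exp (\<i> * of_real (\<tau> * x)) * of_real (normal_density 0 \<sigma> x))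
     = \<bar>\<sigma>\<bar> *\<^sub>R (LINT x|lborel. exp (\<i> * of_real (\<tau> * (0 + \<sigma> * x))) * complex_of_real (normal_density 0 \<sigma> (0 + \<sigma> * x)))"
    using s by (intro lborel_integral_real_affine) auto
  also have "\<dots> = (LINT x|lborel. \<bar>\<sigma>\<bar> *\<^sub>R (exp (\<i> * of_real (\<tau> * (0 + \<sigma> * x))) * complex_of_real (normal_density 0 \<sigma> (0 + \<sigma> * x))))"
    by simp
  also have "\<dots> = (LINT x|lborel. std_normal_density x *\<^sub>R exp (\<i> * of_real (\<tau> * \<sigma> * x)))"
    using s by (intro Bochner_Integration.integral_cong refl)
      (simp add: normal_density_def real_sqrt_mult power_mult_distrib scaleR_conv_of_real mult_ac)
  also have "\<dots> = char std_normal_distribution (\<tau> * \<sigma>)"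
    unfolding char_def by (subst integral_density) (auto simp: normal_density_nonneg)
  also have "\<dots> = exp (- of_real (\<sigma>\<^sup>2 * \<tau>\<^sup>2 / 2))"
    by (simp add: char_std_normal_distribution exp_of_real power_mult_distrib mult_ac flip: exp_of_real)
  finally show ?thesis .
qed

text \<open>
  The characteristic function of a normal distribution, coordinate by coordinate: in Fourier
  variables $e^{t\Delta}$ is multiplication by $e^{-4\pi^2t|y|^2}$.
\<close>

lemma heat_kernel_fourier:
  fixes y :: "'a::euclidean_space"
  assumes t: "0 < t"
  shows "(LINT x|lborel. exp (\<i> * of_real (2 * pi * (x \<bullet> y))) * of_real (heat_kernel t x))
     = exp (- of_real (4 * pi\<^sup>2 * t * (norm y)\<^sup>2))"
proof -
  have "(LINT x|lborel. exp (\<i> * of_real (2 * pi * (x \<bullet> y))) * of_real (heat_kernel t x))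
     = (LINT x|lborel. (\<Prod>b\<in>Basis. exp (\<i> * of_real ((2 * pi * (y \<bullet> b)) * (x \<bullet> b)))
         * complex_of_real (normal_density 0 (sqrt (2 * t)) (x \<bullet> b))))"
    by (intro Bochner_Integration.integral_cong refl)
       (simp add: heat_kernel_def prod.distrib euclidean_inner[of _ y] sum_distrib_left mult_ac
          flip: exp_sum)
  also have "\<dots> = (\<Prod>b\<in>Basis. LINT s|lborel. exp (\<i> * of_real ((2 * pi * (y \<bullet> b)) * s))
         * complex_of_real (normal_density 0 (sqrt (2 * t)) s))"
  proof (rule lborel_integral_prod)
    fix b :: 'a assume "b \<in> Basis"
    show "integrable lborel (\<lambda>s. exp (\<i> * of_real ((2 * pi * (y \<bullet> b)) * s))
         * complex_of_real (normal_density 0 (sqrt (2 * t)) s))"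
      using t by (intro Bochner_Integration.integrable_bound[OF integrable_normal_density[of "sqrt (2 * t)" 0]])
         (auto simp: norm_mult)
  qed
  also have "\<dots> = (\<Prod>b\<in>Basis. exp (- of_real (4 * pi\<^sup>2 * t * (y \<bullet> b)\<^sup>2)))"
    using t by (subst normal_density_char) (auto simp: power_mult_distrib mult_ac)
  also have "\<dots> = exp (- of_real (4 * pi\<^sup>2 * t * (norm y)\<^sup>2))"
    by (simp add: norm_power2_eq_sum_Basis sum_negf sum_distrib_left flip: exp_sum)
  finally show ?thesis .
qed

section \<open>Gamma weights on the half-line\<close>

text \<open>
  The density $t^{a-1}/\Gamma(a)$ of the Riemann--Liouville integral of order $a$ on the half-line.
  Integrating a semigroup $e^{-tA}$ against it gives $A^{-a}$.
\<close>

definition gamma_weight :: "real \<Rightarrow> real \<Rightarrow> real" where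
  "gamma_weight a t = (if 0 < t then t powr (a - 1) / Gamma a else 0)"

lemma gamma_weight_nonneg [simp]: "0 < a \<Longrightarrow> 0 \<le> gamma_weight a t"
  by (simp add: gamma_weight_def)

lemma measurable_gamma_weight [measurable]: "gamma_weight a \<in> borel_measurable borel"
  unfolding gamma_weight_def by measurable

lemma nn_integral_gamma_weight_exp:
  assumes a: "0 < a" and c: "0 < c"
  shows "(\<integral>\<^sup>+t. ennreal (gamma_weight a t * exp (- c * t)) \<partial>lborel) = ennreal (c powr (- a))"
proof -
  have "(\<integral>\<^sup>+t. ennreal (gamma_weight a t * exp (- c * t)) \<partial>lborel)
      = ennreal (1 / c) * (\<integral>\<^sup>+t. ennreal (gamma_weight a (0 + 1 / c * t) * exp (- c * (0 + 1 / c * t))) \<partial>lborel)"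
    using c by (subst nn_integral_real_affine[of _ "1 / c" 0]) auto
  also have "\<dots> = ennreal (1 / c) * (\<integral>\<^sup>+t. ennreal (1 / c powr (a - 1) / Gamma a) * (ennreal (t powr (a - 1) / exp t) * indicator {0..} t) \<partial>lborel)"
    using c a by (intro arg_cong[where f="(*) _"] nn_integral_cong)
      (auto simp: gamma_weight_def powr_divide exp_minus field_simps ennreal_mult'[symmetric] split: split_indicator)
  also have "\<dots> = ennreal (1 / c) * (ennreal (1 / c powr (a - 1) / Gamma a) * ennreal (Gamma a))"
    by (subst nn_integral_cmult, measurable,
        subst nn_integral_has_integral_lebesgue'[OF _ Gamma_integral_real]) (use a in auto)
  also have "\<dots> = ennreal (c powr (- a))"
    using a c Gamma_real_pos[OF a, THEN less_imp_neq]
    by (simp add: ennreal_mult'[symmetric] powr_diff powr_minus divide_simps)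
  finally show ?thesis .
qed

text \<open>
  Scaling reduces the convolution to the Beta integral $B(b,a)=\Gamma(a)\Gamma(b)/\Gamma(a+b)$; the
  normalisation by $\Gamma$ makes the family a convolution semigroup in $a$.
\<close>

lemma gamma_weight_convolution:
  assumes a: "0 < a" and b: "0 < b"
  shows "(\<integral>\<^sup>+u. ennreal (gamma_weight a (r - u) * gamma_weight b u) \<partial>lborel) = ennreal (gamma_weight (a + b) r)"
proof (cases "0 < r")
  case False
  then have "gamma_weight a (r - u) * gamma_weight b u = 0" for u
    by (simp add: gamma_weight_def)
  then have "(\<integral>\<^sup>+u. ennreal (gamma_weight a (r - u) * gamma_weight b u) \<partial>lborel) = 0"
    by (simp only: ennreal_0 nn_integral_const mult_zero_left)
  then show ?thesis using False by (simp add: gamma_weight_def)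
next
  case r: True
  define C where "C = r powr (a + b - 2) / (Gamma a * Gamma b)"
  have G: "0 < Gamma a" "0 < Gamma b" "0 < Gamma (a + b)"
    using a b by (auto intro: Gamma_real_pos)
  have C: "0 \<le> C" using G by (simp add: C_def)
  have "(\<integral>\<^sup>+u. ennreal (gamma_weight a (r - u) * gamma_weight b u) \<partial>lborel)
      = ennreal r * (\<integral>\<^sup>+v. ennreal (gamma_weight a (r - (0 + r * v)) * gamma_weight b (0 + r * v)) \<partial>lborel)"
    using r by (subst nn_integral_real_affine[of _ r 0]) auto
  also have "\<dots> = ennreal r * (\<integral>\<^sup>+v. ennreal C * (ennreal (v powr (b - 1) * (1 - v) powr (a - 1)) * indicator {0..1} v) \<partial>lborel)"
  proof (intro arg_cong[where f="(*) _"] nn_integral_cong)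
    fix v :: real
    have "gamma_weight a (r - r * v) * gamma_weight b (r * v)
        = C * (v powr (b - 1) * (1 - v) powr (a - 1))" if "0 < v" "v < 1"
    proof -
      have "r - r * v = r * (1 - v)" by (simp add: algebra_simps)
      moreover have "r powr (a + b - 2) = r powr (a - 1) * r powr (b - 1)"
        by (simp add: powr_add[symmetric])
      ultimately show ?thesis
        using r that by (simp add: gamma_weight_def C_def powr_mult)
    qed
    moreover have "gamma_weight a (r - r * v) * gamma_weight b (r * v) = 0" if "\<not> (0 < v \<and> v < 1)"
      using r that by (auto simp: gamma_weight_def zero_less_mult_iff mult_less_cancel_left2)
    ultimately show "ennreal (gamma_weight a (r - (0 + r * v)) * gamma_weight b (0 + r * v))
        = ennreal C * (ennreal (v powr (b - 1) * (1 - v) powr (a - 1)) * indicator {0..1} v)"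
      using C by (cases "0 < v \<and> v < 1")
        (auto simp: ennreal_mult'[symmetric] less_eq_real_def split: split_indicator)
  qed
  also have "\<dots> = ennreal r * (ennreal C * ennreal (Beta b a))"
    by (subst nn_integral_cmult, measurable,
        subst nn_integral_has_integral_lebesgue'[OF _ has_integral_Beta_real]) (use a b in auto)
  also have "\<dots> = ennreal (gamma_weight (a + b) r)"
  proof -
    have "r * r powr (a + b - 2) = r powr (a + b - 1)"
      using r by (simp add: powr_mult_base)
    then have "r * (C * Beta b a) = gamma_weight (a + b) r"
      using G r by (simp add: gamma_weight_def C_def Beta_def add.commute divide_simps)
    then show ?thesis
      using C r by (simp only: ennreal_mult'[symmetric])
  qed
  finally show ?thesis .
qed

text \<open>
  The substitution $t = 1/w$ turns a superposition of heat kernels, in which the time occurs as $e^{-|x|^2/(4t)}$, into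
  a Gamma integral.
\<close>

lemma nn_integral_inverse_substitution:
  fixes f :: "real \<Rightarrow> real"
  assumes [measurable]: "f \<in> borel_measurable borel" and nn: "\<And>t. 0 < t \<Longrightarrow> 0 \<le> f t" and c: "0 \<le> c"
    and int: "(\<integral>\<^sup>+w. ennreal (inverse (w\<^sup>2) * f (inverse w)) * indicator {0<..} w \<partial>lborel) = ennreal c"
  shows "(\<integral>\<^sup>+t. ennreal (f t) * indicator {0<..} t \<partial>lborel) = ennreal c"
proof -
  let ?h = "\<lambda>w::real. inverse (w\<^sup>2) * f (inverse w)"
  have "((\<lambda>w. ?h w * indicator {0<..} w) has_integral c) UNIV"
    using nn c int by (intro nn_integral_has_integral)
      (auto simp: split: split_indicator intro!: trans[OF nn_integral_cong int])
  then have h: "(?h has_integral c) {0<..}"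
    by (subst has_integral_restrict_UNIV[symmetric])
       (simp add: indicator_def of_bool_def if_distrib cong: if_cong)
  have "?h absolutely_integrable_on {0<..}"
    using h nn by (intro nonnegative_absolutely_integrable_1) (auto simp: has_integral_integrable_integral)
  with h have "(\<lambda>w. \<bar>- inverse (w\<^sup>2)\<bar> * f (inverse w)) absolutely_integrable_on {0<..} \<and>
      integral {0<..} (\<lambda>w. \<bar>- inverse (w\<^sup>2)\<bar> * f (inverse w)) = c"
    by (auto simp: integral_unique)
  moreover have "inj_on inverse {0::real<..}"
    by (auto simp: inj_on_def)
  moreover have "(inverse has_field_derivative - inverse (w\<^sup>2)) (at w within {0<..})" if "w \<in> {0<..}" for w :: real
    using that by (auto intro!: derivative_eq_intros simp: power2_eq_square)
  ultimately have "f absolutely_integrable_on inverse ` {0<..} \<and> integral (inverse ` {0<..}) f = c"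
    using has_absolute_integral_change_of_variables_1'[of "{0<..}" inverse "\<lambda>w. - inverse (w\<^sup>2)" f c]
    by simp
  moreover have "inverse ` {0::real<..} = {0<..}"
  proof (intro equalityI subsetI)
    show "t \<in> inverse ` {0<..}" if "t \<in> {0<..}" for t :: real
      using that by (intro image_eqI[of _ _ "inverse t"]) auto
  qed auto
  ultimately have "(f has_integral c) {0<..}"
    by (simp add: has_integral_integrable_integral absolutely_integrable_on_def)
  then show ?thesis
    using nn by (intro nn_integral_has_integral_lebesgue') auto
qed

section \<open>Riesz kernels\<close>

text \<open>
  The kernel of $(-\Delta)^{-a/2}$, as the superposition of heat kernels that represents this negative
  power. It is extended-valued because the integral diverges at the origin.
\<close>

definition riesz_kernel :: "real \<Rightarrow> 'a::euclidean_space \<Rightarrow> ennreal" where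
  "riesz_kernel a x = (\<integral>\<^sup>+t. ennreal (gamma_weight (a / 2) t * heat_kernel t x) \<partial>lborel)"

lemma measurable_riesz_kernel [measurable]:
  "riesz_kernel a \<in> borel_measurable borel"
  unfolding riesz_kernel_def by measurable

lemma riesz_kernel_minus_commute: "riesz_kernel a (x - y) = riesz_kernel a (y - x)"
  unfolding riesz_kernel_def by (simp only: heat_kernel_minus_commute[of _ x y])

text \<open>
  The factor in front of $|x|^{a-n}$ in the Riesz kernel of order $a$ on $\mathbb R^n$.
\<close>

definition riesz_const :: "real \<Rightarrow> real \<Rightarrow> real" where
  "riesz_const n a = Gamma ((n - a) / 2) / (pi powr (n / 2) * 2 powr a * Gamma (a / 2))"

text \<open>
  In the variable $w=1/t$ the defining integral is a Gamma integral of order $(n-a)/2$ in $|x|^2/4$, which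
  converges because $a<n$.
\<close>

lemma riesz_kernel_eq:
  fixes x :: "'a::euclidean_space"
  assumes a: "0 < a" and an: "a < real DIM('a)" and x: "x \<noteq> 0"
  shows "riesz_kernel a x = ennreal (riesz_const DIM('a) a * norm x powr (a - real DIM('a)))"
proof -
  define n where "n = real DIM('a)"
  define q where "q = (n - a) / 2"
  have q: "0 < q" using an by (simp add: q_def n_def)
  define k where "k = (norm x)\<^sup>2 / 4"
  have lam: "0 < k" using x by (simp add: k_def)
  let ?K = "(4 * pi) powr (- n / 2) * Gamma q / Gamma (a / 2)"
  have G: "0 < Gamma (a / 2)" "0 < Gamma q" using a q by (auto intro: Gamma_real_pos)
  have int: "(\<integral>\<^sup>+w. ennreal (inverse (w\<^sup>2) * (gamma_weight (a / 2) (inverse w) * heat_kernel (inverse w) x))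
      * indicator {0<..} w \<partial>lborel) = ennreal (?K * k powr (- q))"
  proof -
    have "ennreal (inverse (w\<^sup>2) * (gamma_weight (a / 2) (inverse w) * heat_kernel (inverse w) x)) * indicator {0<..} w
       = ennreal ?K * ennreal (gamma_weight q w * exp (- k * w))" for w
    proof (cases "0 < w")
      case w: True
      have "inverse (w\<^sup>2) * (inverse w powr (a / 2 - 1) * (4 * pi * inverse w) powr (- n / 2))
          = (4 * pi) powr (- n / 2) * w powr (q - 1)"
      proof -
        have "inverse (w\<^sup>2) = w powr (- 2)"
          using w by (simp add: powr_minus)
        moreover have "inverse w powr (a / 2 - 1) = w powr (1 - a / 2)"
          using w by (simp add: powr_minus[symmetric] inverse_powr)
        moreover have "(4 * pi * inverse w) powr (- n / 2) = (4 * pi) powr (- n / 2) * w powr (n / 2)"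
          using w by (simp add: powr_mult inverse_powr powr_minus[symmetric])
        moreover have "w powr (- 2) * (w powr (1 - a / 2) * w powr (n / 2)) = w powr (q - 1)"
          by (simp add: powr_add[symmetric] q_def field_simps)
        ultimately show ?thesis by (simp add: mult_ac)
      qed
      moreover have "heat_kernel (inverse w) x = (4 * pi * inverse w) powr (- n / 2) * exp (- k * w)"
        using w by (subst heat_kernel_eq) (auto simp: n_def k_def field_simps)
      ultimately have "inverse (w\<^sup>2) * (gamma_weight (a / 2) (inverse w) * heat_kernel (inverse w) x)
          = ?K * (gamma_weight q w * exp (- k * w))"
        using w G by (simp add: gamma_weight_def divide_simps mult_ac)
      then show ?thesis
        using w G by (simp add: ennreal_mult'[symmetric])
    qed (simp add: gamma_weight_def)
    then have "(\<integral>\<^sup>+w. ennreal (inverse (w\<^sup>2) * (gamma_weight (a / 2) (inverse w) * heat_kernel (inverse w) x))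
      * indicator {0<..} w \<partial>lborel) = ennreal ?K * (\<integral>\<^sup>+w. ennreal (gamma_weight q w * exp (- k * w)) \<partial>lborel)"
      by (simp add: nn_integral_cmult)
    also have "\<dots> = ennreal ?K * ennreal (k powr (- q))"
      using nn_integral_gamma_weight_exp[OF q lam] by simp
    also have "\<dots> = ennreal (?K * k powr (- q))"
      using G by (intro ennreal_mult'[symmetric]) simp
    finally show ?thesis .
  qed
  have "riesz_kernel a x = (\<integral>\<^sup>+t. ennreal (gamma_weight (a / 2) t * heat_kernel t x) * indicator {0<..} t \<partial>lborel)"
    unfolding riesz_kernel_def
    by (intro nn_integral_cong) (auto simp: gamma_weight_def split: split_indicator)
  also have "\<dots> = ennreal (?K * k powr (- q))"
  proof (rule nn_integral_inverse_substitution)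
    show "0 \<le> gamma_weight (a / 2) t * heat_kernel t x" for t
      using a by simp
    show "0 \<le> ?K * k powr (- q)"
      using G by simp
  qed (measurable, fact int)
  also have "?K * k powr (- q) = riesz_const n a * norm x powr (a - n)"
  proof -
    have "k = (norm x / 2) powr 2"
      using x by (simp add: k_def power_divide)
    then have "k powr (- q) = (norm x / 2) powr (2 * - q)"
      by (simp only: powr_powr)
    also have "2 * - q = a - n"
      by (simp add: q_def field_simps)
    also have "(norm x / 2) powr (a - n) = norm x powr (a - n) * 2 powr (n - a)"
      by (simp add: powr_divide powr_minus[symmetric] divide_simps powr_add[symmetric] flip: powr_minus)
    finally have 1: "k powr (- q) = norm x powr (a - n) * 2 powr (n - a)" .
    have "(4::real) = 2 powr 2" by simp
    then have "(4::real) powr (- n / 2) = 2 powr (- n)"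
      by (simp only: powr_powr) simp
    then have "(4 * pi) powr (- n / 2) * 2 powr (n - a) = pi powr (- n / 2) * 2 powr (- a)"
      by (simp add: powr_mult powr_add[symmetric] mult.assoc mult.left_commute)
    then have "?K * k powr (- q) = pi powr (- n / 2) * 2 powr (- a) * Gamma q / Gamma (a / 2) * norm x powr (a - n)"
      unfolding 1 by (simp add: divide_simps mult_ac)
    also have "\<dots> = riesz_const n a * norm x powr (a - n)"
      by (simp add: riesz_const_def powr_minus q_def divide_simps)
    finally show ?thesis .
  qed
  finally show ?thesis by (simp add: n_def)
qed

text \<open>
  $(-\Delta)^{-a/2}(-\Delta)^{-b/2} = (-\Delta)^{-(a+b)/2}$ at the level of kernels. The heat
  semigroup law turns the product of the kernels at times $t$ and $u$ into the kernel at time $t+u$, and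
  the two weights then convolve to the weight of order $(a+b)/2$. This stands in for a direct evaluation of
  $\int |x-y|^{a-n}|y|^{b-n}\,dy$.
\<close>

lemma riesz_kernel_convolution:
  fixes x :: "'a::euclidean_space"
  assumes a: "0 < a" and b: "0 < b"
  shows "(\<integral>\<^sup>+y. riesz_kernel a (x - y) * riesz_kernel b y \<partial>lborel) = riesz_kernel (a + b) x"
proof -
  let ?g = "gamma_weight (a / 2)" and ?h = "gamma_weight (b / 2)"
  have "(\<integral>\<^sup>+y. riesz_kernel a (x - y) * riesz_kernel b y \<partial>lborel)
     = (\<integral>\<^sup>+y. (\<integral>\<^sup>+u. (\<integral>\<^sup>+t. ennreal (?g t) * ennreal (?h u) * ennreal (heat_kernel t (x - y) * heat_kernel u y) \<partial>lborel) \<partial>lborel) \<partial>lborel)"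
  proof (intro nn_integral_cong)
    fix y :: 'a
    have "(\<integral>\<^sup>+u. (\<integral>\<^sup>+t. ennreal (?g t) * ennreal (?h u) * ennreal (heat_kernel t (x - y) * heat_kernel u y) \<partial>lborel) \<partial>lborel)
       = (\<integral>\<^sup>+u. (\<integral>\<^sup>+t. ennreal (?g t * heat_kernel t (x - y)) * ennreal (?h u * heat_kernel u y) \<partial>lborel) \<partial>lborel)"
      using a b by (simp add: ennreal_mult mult_ac)
    also have "\<dots> = riesz_kernel a (x - y) * riesz_kernel b y"
      by (simp add: nn_integral_multc nn_integral_cmult riesz_kernel_def)
    finally show "riesz_kernel a (x - y) * riesz_kernel b y
     = (\<integral>\<^sup>+u. (\<integral>\<^sup>+t. ennreal (?g t) * ennreal (?h u) * ennreal (heat_kernel t (x - y) * heat_kernel u y) \<partial>lborel) \<partial>lborel)" ..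
  qed
  also have "\<dots> = (\<integral>\<^sup>+u. (\<integral>\<^sup>+y. (\<integral>\<^sup>+t. ennreal (?g t) * ennreal (?h u) * ennreal (heat_kernel t (x - y) * heat_kernel u y) \<partial>lborel) \<partial>lborel) \<partial>lborel)"
    by (rule lborel_pair.Fubini'[symmetric]) measurable
  also have "\<dots> = (\<integral>\<^sup>+u. (\<integral>\<^sup>+t. (\<integral>\<^sup>+y. ennreal (?g t) * ennreal (?h u) * ennreal (heat_kernel t (x - y) * heat_kernel u y) \<partial>lborel) \<partial>lborel) \<partial>lborel)"
    by (rule nn_integral_cong, rule lborel_pair.Fubini'[symmetric]) measurable
  also have "\<dots> = (\<integral>\<^sup>+u. (\<integral>\<^sup>+t. ennreal (?g t) * ennreal (?h u) * ennreal (heat_kernel (t + u) x) \<partial>lborel) \<partial>lborel)"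
  proof (intro nn_integral_cong)
    fix u t :: real
    show "(\<integral>\<^sup>+y. ennreal (?g t) * ennreal (?h u) * ennreal (heat_kernel t (x - y) * heat_kernel u y) \<partial>lborel)
       = ennreal (?g t) * ennreal (?h u) * ennreal (heat_kernel (t + u) x)"
    proof (cases "0 < t \<and> 0 < u")
      case True
      then show ?thesis
        by (subst nn_integral_cmult) (simp_all add: heat_kernel_semigroup)
    qed (auto simp: gamma_weight_def)
  qed
  also have "\<dots> = (\<integral>\<^sup>+u. (\<integral>\<^sup>+r. ennreal (?g (r - u)) * ennreal (?h u) * ennreal (heat_kernel r x) \<partial>lborel) \<partial>lborel)"
  proof (rule nn_integral_cong)
    fix u :: real
    show "(\<integral>\<^sup>+t. ennreal (?g t) * ennreal (?h u) * ennreal (heat_kernel (t + u) x) \<partial>lborel)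
        = (\<integral>\<^sup>+r. ennreal (?g (r - u)) * ennreal (?h u) * ennreal (heat_kernel r x) \<partial>lborel)"
      by (subst nn_integral_real_affine[where f="\<lambda>r. ennreal (?g (r - u)) * ennreal (?h u) * ennreal (heat_kernel r x)" and c=1 and t=u])
        (simp_all add: add.commute[of u])
  qed
  also have "\<dots> = (\<integral>\<^sup>+r. (\<integral>\<^sup>+u. ennreal (?g (r - u)) * ennreal (?h u) * ennreal (heat_kernel r x) \<partial>lborel) \<partial>lborel)"
    by (rule lborel_pair.Fubini') measurable
  also have "\<dots> = (\<integral>\<^sup>+r. ennreal (gamma_weight (a / 2 + b / 2) r) * ennreal (heat_kernel r x) \<partial>lborel)"
    using gamma_weight_convolution[of "a / 2" "b / 2"] a b
    by (intro nn_integral_cong) (subst nn_integral_multc, simp_all add: ennreal_mult)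
  also have "\<dots> = riesz_kernel (a + b) x"
    using a b by (simp add: riesz_kernel_def ennreal_mult add_divide_distrib)
  finally show ?thesis .
qed

section \<open>The Schur test\<close>

text \<open>
  This is Hoelder's inequality for the splitting $f = \varphi\cdot(f/\varphi)$ and the measure $k(y)\,dy$, raised to the
  power $p$. It is derived from Young's inequality with a free scale $l$ on the two factors. The scale is chosen so
  that the $q$-term is exactly $u/q$, which is absorbed into the left-hand side.
\<close>

lemma schur_test_pointwise:
  fixes k :: "'a::euclidean_space \<Rightarrow> ennreal" and f \<phi> :: "'a \<Rightarrow> real"
  assumes pq: "1 < p" "1 < q" "1 / p + 1 / q = 1" and A: "0 < A" and c: "0 < c" and u: "0 \<le> u"
    and [measurable]: "k \<in> borel_measurable borel" "f \<in> borel_measurable borel" "\<phi> \<in> borel_measurable borel"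
    and f: "\<And>y. 0 \<le> f y" and \<phi>: "AE y in lborel. 0 < \<phi> y"
    and row: "(\<integral>\<^sup>+y. k y * ennreal (\<phi> y powr q) \<partial>lborel) \<le> ennreal (A * c powr q)"
    and bound: "ennreal u \<le> (\<integral>\<^sup>+y. k y * ennreal (f y) \<partial>lborel)"
  shows "ennreal (u powr p) \<le> ennreal (A powr (p / q) * c powr p) * (\<integral>\<^sup>+y. k y * ennreal ((f y / \<phi> y) powr p) \<partial>lborel)"
    (is "_ \<le> _ * ?J")
proof (cases "u = 0 \<or> ?J = top")
  case True
  then show ?thesis using A c by (auto simp: ennreal_mult_top)
next
  case False
  then obtain j where j: "?J = ennreal j" "0 \<le> j" by (cases ?J) auto
  from False u have u: "0 < u" by simp
  \<comment> \<open>This scale solves $l^q A c^q = u$, where $A c^q$ bounds the row integral.\<close>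
  define l where "l = (u / (A * c powr q)) powr (1 / q)"
  have l: "0 < l" using u A c by (simp add: l_def)
  have lq: "l powr q * (A * c powr q) = u"
    using u A c pq by (simp add: l_def powr_powr)
  have "ennreal u \<le> (\<integral>\<^sup>+y. k y * ennreal (f y) \<partial>lborel)" by (fact bound)
  also have "\<dots> \<le> (\<integral>\<^sup>+y. ennreal (l powr q / q) * (k y * ennreal (\<phi> y powr q))
       + ennreal (l powr (- p) / p) * (k y * ennreal ((f y / \<phi> y) powr p)) \<partial>lborel)"
  proof (rule nn_integral_mono_AE, use \<phi> in eventually_elim)
    fix y assume y: "0 < \<phi> y"
    \<comment> \<open>Young's inequality for the factors $l\varphi$ and $f/(l\varphi)$.\<close>
    have "f y = (l * \<phi> y) * (f y / \<phi> y / l)"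
      using y l by simp
    also have "\<dots> \<le> (l * \<phi> y) powr q / q + (f y / \<phi> y / l) powr p / p"
      using pq y l f by (intro Youngs_inequality) (auto simp: add.commute)
    also have "\<dots> = l powr q / q * \<phi> y powr q + l powr (- p) / p * (f y / \<phi> y) powr p"
      using y l f by (simp add: powr_mult powr_divide powr_minus divide_simps)
    finally have "ennreal (f y) \<le> ennreal (l powr q / q) * ennreal (\<phi> y powr q)
        + ennreal (l powr (- p) / p) * ennreal ((f y / \<phi> y) powr p)"
      using pq by (simp add: ennreal_mult'[symmetric] ennreal_plus[symmetric] del: ennreal_plus)
    then have "k y * ennreal (f y) \<le> k y * (ennreal (l powr q / q) * ennreal (\<phi> y powr q)
        + ennreal (l powr (- p) / p) * ennreal ((f y / \<phi> y) powr p))"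
      by (rule mult_left_mono) simp
    then show "k y * ennreal (f y) \<le> ennreal (l powr q / q) * (k y * ennreal (\<phi> y powr q))
        + ennreal (l powr (- p) / p) * (k y * ennreal ((f y / \<phi> y) powr p))"
      by (simp add: ring_distribs mult_ac)
  qed
  also have "\<dots> = ennreal (l powr q / q) * (\<integral>\<^sup>+y. k y * ennreal (\<phi> y powr q) \<partial>lborel) + ennreal (l powr (- p) / p) * ?J"
    by (simp add: nn_integral_add nn_integral_cmult)
  also have "\<dots> \<le> ennreal (l powr q / q) * ennreal (A * c powr q) + ennreal (l powr (- p) / p) * ennreal j"
    unfolding j by (intro add_mono mult_left_mono row) auto
  also have "\<dots> = ennreal (l powr q / q * (A * c powr q) + l powr (- p) / p * j)"
    using A c j pq by (simp add: ennreal_mult'[symmetric] ennreal_plus[symmetric] del: ennreal_plus)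
  finally have "u \<le> l powr q / q * (A * c powr q) + l powr (- p) / p * j"
    using j pq A c by (subst (asm) ennreal_le_iff) auto
  also have "l powr q / q * (A * c powr q) = u / q" using lq by simp
  also have "u / q = u - u / p"
    using pq(3) by (metis add_diff_cancel_left' mult.right_neutral right_diff_distrib times_divide_eq_right)
  finally have "u / p \<le> l powr (- p) * j / p" by simp
  then have "u \<le> l powr (- p) * j" using pq by (simp add: divide_simps)
  then have "u * l powr p \<le> l powr (- p) * l powr p * j"
    using mult_right_mono[of u "l powr (- p) * j" "l powr p"] by (simp only: mult_ac powr_ge_zero)
  then have 1: "u * l powr p \<le> j" using l by (simp add: powr_add[symmetric])
  \<comment> \<open>By the choice of $l$, multiplying $u\,l^p\le j$ by $A^{p/q}c^p$ gives the claim.\<close>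
  have e: "1 + p / q = p" using pq by (simp add: field_simps)
  have "u powr p = u * u powr (p / q)"
    by (subst e[symmetric], subst powr_add) (use u in simp)
  also have "\<dots> = u * l powr p * (A powr (p / q) * c powr p)"
    using u A c pq by (simp add: l_def powr_powr powr_divide powr_mult)
  also have "\<dots> \<le> j * (A powr (p / q) * c powr p)"
    using 1 by (intro mult_right_mono) auto
  finally show ?thesis
    using j by (simp add: ennreal_mult'[symmetric] mult.commute)
qed

text \<open>
  The Schur test with one weight $\varphi$ and one constant $A$ for both the rows and the columns of $K$: the pointwise bound
  uses the rows and contributes $A^{p/q}$; after an exchange of integrals the columns contribute one more factor
  $A$, and $p/q+1=p$.
\<close>

lemma schur_test:
  fixes K :: "'a::euclidean_space \<Rightarrow> 'a \<Rightarrow> ennreal" and f \<phi> u :: "'a \<Rightarrow> real"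
  assumes pq: "1 < p" "1 < q" "1 / p + 1 / q = 1" and A: "0 < A"
    and [measurable]: "case_prod K \<in> borel_measurable (borel \<Otimes>\<^sub>M borel)"
      "f \<in> borel_measurable borel" "\<phi> \<in> borel_measurable borel" "u \<in> borel_measurable borel"
    and f: "\<And>y. 0 \<le> f y" and u: "\<And>x. 0 \<le> u x" and \<phi>: "AE y in lborel. 0 < \<phi> y"
    and row: "AE x in lborel. (\<integral>\<^sup>+y. K x y * ennreal (\<phi> y powr q) \<partial>lborel) \<le> ennreal (A * \<phi> x powr q)"
    and col: "AE y in lborel. (\<integral>\<^sup>+x. K x y * ennreal (\<phi> x powr p) \<partial>lborel) \<le> ennreal (A * \<phi> y powr p)"
    and bound: "AE x in lborel. ennreal (u x) \<le> (\<integral>\<^sup>+y. K x y * ennreal (f y) \<partial>lborel)"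
  shows "(\<integral>\<^sup>+x. ennreal (u x powr p) \<partial>lborel) \<le> ennreal (A powr p) * (\<integral>\<^sup>+y. ennreal (f y powr p) \<partial>lborel)"
proof -
  let ?B = "A powr (p / q)" and ?g = "\<lambda>y. (f y / \<phi> y) powr p"
  have "(\<integral>\<^sup>+x. ennreal (u x powr p) \<partial>lborel)
     \<le> (\<integral>\<^sup>+x. ennreal (?B * \<phi> x powr p) * (\<integral>\<^sup>+y. K x y * ennreal (?g y) \<partial>lborel) \<partial>lborel)"
  proof (rule nn_integral_mono_AE, use row bound \<phi> in eventually_elim)
    case (elim x)
    show ?case
      by (rule schur_test_pointwise[OF pq A elim(3) u _ _ _ f \<phi> elim(1,2)]) measurable
  qed
  also have "\<dots> = (\<integral>\<^sup>+x. (\<integral>\<^sup>+y. ennreal ?B * (ennreal (\<phi> x powr p) * K x y * ennreal (?g y)) \<partial>lborel) \<partial>lborel)"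
    by (simp add: nn_integral_cmult[symmetric] ennreal_mult' mult_ac)
  also have "\<dots> = (\<integral>\<^sup>+y. (\<integral>\<^sup>+x. ennreal ?B * (ennreal (\<phi> x powr p) * K x y * ennreal (?g y)) \<partial>lborel) \<partial>lborel)"
    by (rule lborel_pair.Fubini'[symmetric]) measurable
  also have "\<dots> = (\<integral>\<^sup>+y. ennreal ?B * ennreal (?g y) * (\<integral>\<^sup>+x. K x y * ennreal (\<phi> x powr p) \<partial>lborel) \<partial>lborel)"
    by (simp add: nn_integral_cmult[symmetric] mult_ac)
  also have "\<dots> \<le> (\<integral>\<^sup>+y. ennreal (A powr p) * ennreal (f y powr p) \<partial>lborel)"
  proof (rule nn_integral_mono_AE, use col \<phi> in eventually_elim)
    case (elim y)
    have e: "p = 1 + p / q" using pq by (simp add: field_simps)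
    have "ennreal ?B * ennreal (?g y) * (\<integral>\<^sup>+x. K x y * ennreal (\<phi> x powr p) \<partial>lborel)
        \<le> ennreal ?B * ennreal (?g y) * ennreal (A * \<phi> y powr p)"
      by (intro mult_left_mono elim) auto
    also have "\<dots> = ennreal (?B * ?g y * (A * \<phi> y powr p))"
      by (simp add: ennreal_mult'[symmetric])
    also have "?B * ?g y * (A * \<phi> y powr p) = (?B * A) * f y powr p"
      using elim(2) f by (simp add: powr_divide)
    also have "?B * A = A powr p"
      by (subst (2) e, subst powr_add) (use A in simp)
    finally show ?case by (simp add: ennreal_mult')
  qed
  also have "\<dots> = ennreal (A powr p) * (\<integral>\<^sup>+y. ennreal (f y powr p) \<partial>lborel)"
    by (simp add: nn_integral_cmult)
  finally show ?thesis .
qed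

section \<open>The Stein--Weiss inequality\<close>

lemma riesz_const_pos: "0 < a \<Longrightarrow> a < n \<Longrightarrow> 0 < riesz_const n a"
  unfolding riesz_const_def by (intro divide_pos_pos mult_pos_pos Gamma_real_pos) auto

text \<open>
  A power of $|y|$ is a multiple of a Riesz kernel, so its Riesz potential is again one, by the semigroup law.
\<close>

lemma riesz_potential_of_power:
  fixes x :: "'a::euclidean_space"
  assumes "0 < a" "0 < b" "a + b < real DIM('a)" "x \<noteq> 0"
  shows "(\<integral>\<^sup>+y. riesz_kernel a (x - y) * ennreal (norm y powr (b - real DIM('a))) \<partial>lborel)
     = ennreal (riesz_const DIM('a) (a + b) / riesz_const DIM('a) b * norm x powr (a + b - real DIM('a)))"
proof -
  let ?n = "real DIM('a)"
  have pos: "0 < riesz_const ?n b" using assms by (intro riesz_const_pos) auto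
  have "(\<integral>\<^sup>+y. riesz_kernel a (x - y) * ennreal (norm y powr (b - ?n)) \<partial>lborel)
     = (\<integral>\<^sup>+y. ennreal (1 / riesz_const ?n b) * (riesz_kernel a (x - y) * riesz_kernel b y) \<partial>lborel)"
  proof (rule nn_integral_cong_AE, use AE_lborel_nonzero in eventually_elim)
    fix y :: 'a assume y: "y \<noteq> 0"
    have "ennreal (norm y powr (b - ?n)) = ennreal (1 / riesz_const ?n b) * riesz_kernel b y"
      using assms y pos by (subst riesz_kernel_eq) (auto simp: ennreal_mult'[symmetric])
    then show "riesz_kernel a (x - y) * ennreal (norm y powr (b - ?n))
       = ennreal (1 / riesz_const ?n b) * (riesz_kernel a (x - y) * riesz_kernel b y)"
      by (simp add: mult_ac)
  qed
  also have "\<dots> = ennreal (1 / riesz_const ?n b) * riesz_kernel (a + b) x"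
    using assms by (subst nn_integral_cmult) (simp_all add: riesz_kernel_convolution)
  also have "\<dots> = ennreal (riesz_const ?n (a + b) / riesz_const ?n b * norm x powr (a + b - ?n))"
    using assms pos by (subst riesz_kernel_eq) (auto simp: ennreal_mult'[symmetric])
  finally show ?thesis .
qed

text \<open>
  The value that the Schur test gives for the operator $f \mapsto |x|^{-s}(-\Delta)^{-s/2}f$ on
  $L^p(\mathbb R^n)$.
\<close>

definition stein_weiss_const :: "real \<Rightarrow> real \<Rightarrow> real \<Rightarrow> real" where
  "stein_weiss_const n s p = 2 powr (- s) * (Gamma ((n / p - s) / 2) * Gamma ((n - n / p) / 2)
     / (Gamma ((n - n / p + s) / 2) * Gamma (n / p / 2)))"

lemma stein_weiss_const_pos:
  assumes "0 \<le> s" "s < n / p" "1 < p" "0 < n" shows "0 < stein_weiss_const n s p"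
proof -
  have "n / p < n" using assms by (simp add: divide_simps)
  then show ?thesis
  unfolding stein_weiss_const_def using assms by (intro mult_pos_pos divide_pos_pos Gamma_real_pos) auto
qed

text \<open>
  The row constant and the column constant of the Schur test agree. The underlying reason is that
  $\int |x-y|^{a-n}|y|^{b-n}\,dy$ at $|x|=1$ is symmetric in the three exponents $a$, $b$, $n-a-b$.
\<close>

lemma riesz_const_quotients:
  assumes "0 < s" "s < n / p" "1 < p" "0 < n"
  shows "riesz_const n (s + (n - n / p)) / riesz_const n (n - n / p) = stein_weiss_const n s p" (is ?A)
    and "riesz_const n (n / p) / riesz_const n (n / p - s) = stein_weiss_const n s p" (is ?B)
proof -
  have np: "n / p < n" using assms by (simp add: divide_simps)
  have G: "Gamma ((n / p - s) / 2) \<noteq> 0" "Gamma ((n - n / p) / 2) \<noteq> 0"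
     "Gamma ((n - n / p + s) / 2) \<noteq> 0" "Gamma (n / p / 2) \<noteq> 0"
    using assms np by (auto intro!: Gamma_real_pos[THEN less_imp_neq, symmetric])
  have e: "n - (s + (n - n / p)) = n / p - s" "n - (n - n / p) = n / p"
    "n - (n / p - s) = n - n / p + s" "s + (n - n / p) = n - n / p + s" by auto
  have "2 powr (n - n / p + s) = 2 powr (n - n / p) * (2 powr s :: real)"
    by (rule powr_add)
  then show ?A unfolding riesz_const_def stein_weiss_const_def e powr_minus
    using G by (simp add: divide_simps mult_ac)
  show ?B unfolding riesz_const_def stein_weiss_const_def e
    using G by (simp add: powr_diff powr_minus field_simps)
qed

text \<open>
  The kernel $|x|^{-s}|x-y|^{s-n}$ is homogeneous of degree $-n$, so the Schur weight has to be a power of $|y|$. With the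
  weight $|y|^{-n/(pq)}$ the row and column integrals are Riesz potentials of $|y|^{-n/p}$ and $|x|^{-s-n/q}$,
  and both are governed by the same constant.
\<close>

lemma stein_weiss_inequality:
  fixes f u :: "'a::euclidean_space \<Rightarrow> real"
  assumes p: "1 < p" and s: "0 < s" "s < real DIM('a) / p"
    and [measurable]: "f \<in> borel_measurable borel" "u \<in> borel_measurable borel"
    and f: "\<And>y. 0 \<le> f y" and u: "\<And>x. 0 \<le> u x"
    and bound: "\<And>x. ennreal (u x) \<le> (\<integral>\<^sup>+y. riesz_kernel s (x - y) * ennreal (f y) \<partial>lborel)"
  shows "(\<integral>\<^sup>+x. ennreal ((norm x powr (- s) * u x) powr p) \<partial>lborel)
    \<le> ennreal (stein_weiss_const DIM('a) s p powr p) * (\<integral>\<^sup>+y. ennreal (f y powr p) \<partial>lborel)"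
proof -
  define n where "n = real DIM('a)"
  define q where "q = p / (p - 1)"
  have n: "0 < n" by (simp add: n_def)
  have q: "1 < q" "1 / p + 1 / q = 1" using p by (simp_all add: q_def field_simps)
  have nq: "n / q = n - n / p" using p by (simp add: q_def field_simps)
  have np: "n / p < n" using p n by (simp add: divide_simps)
  note s = s[folded n_def]
  let ?C = "stein_weiss_const n s p"
  \<comment> \<open>The exponent is the one for which $\varphi^q$ and $\varphi^p$ are $|y|^{-n/p}$ and $|y|^{-n/q}$.\<close>
  let ?\<phi> = "\<lambda>y::'a. norm y powr (- n / (p * q))"
  let ?K = "\<lambda>(x::'a) y. ennreal (norm x powr (- s)) * riesz_kernel s (x - y)"
  have C: "0 < ?C" using s p n by (intro stein_weiss_const_pos) auto
  have \<phi>q: "?\<phi> y powr q = norm y powr (n / q - n)" for y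
  proof -
    have "?\<phi> y powr q = norm y powr (- n / (p * q) * q)" by (simp add: powr_powr)
    also have "- n / (p * q) * q = n / q - n" using q nq by simp
    finally show ?thesis .
  qed
  have \<phi>p: "?\<phi> y powr p = norm y powr (n / p - n)" for y
  proof -
    have "?\<phi> y powr p = norm y powr (- n / (p * q) * p)" by (simp add: powr_powr)
    also have "- n / (p * q) * p = n / p - n" using p nq by simp
    finally show ?thesis .
  qed
  show ?thesis
    unfolding n_def[symmetric]
  proof (rule schur_test[where K = ?K and \<phi> = ?\<phi> and q = q])
    show "AE y in lborel. 0 < ?\<phi> y"
      using AE_lborel_nonzero by eventually_elim simp
    show "AE x in lborel. (\<integral>\<^sup>+y. ?K x y * ennreal (?\<phi> y powr q) \<partial>lborel) \<le> ennreal (?C * ?\<phi> x powr q)"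
      using AE_lborel_nonzero
    proof eventually_elim
      fix x :: 'a assume x: "x \<noteq> 0"
      have "(\<integral>\<^sup>+y. ?K x y * ennreal (?\<phi> y powr q) \<partial>lborel)
          = ennreal (norm x powr (- s)) * (\<integral>\<^sup>+y. riesz_kernel s (x - y) * ennreal (norm y powr (n / q - n)) \<partial>lborel)"
        unfolding \<phi>q by (subst nn_integral_cmult[symmetric]) (simp_all add: mult_ac)
      also have "\<dots> = ennreal (norm x powr (- s)) * ennreal (?C * norm x powr (s + n / q - n))"
        using riesz_potential_of_power[of s "n / q" x] riesz_const_quotients(1)[of s n p] s p np n x
        by (simp add: n_def[symmetric] nq)
      also have "\<dots> = ennreal (?C * (norm x powr (- s) * norm x powr (s + n / q - n)))"
        by (simp add: ennreal_mult'[symmetric] mult_ac)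
      also have "norm x powr (- s) * norm x powr (s + n / q - n) = ?\<phi> x powr q"
        unfolding \<phi>q by (simp add: powr_add[symmetric])
      finally show "(\<integral>\<^sup>+y. ?K x y * ennreal (?\<phi> y powr q) \<partial>lborel) \<le> ennreal (?C * ?\<phi> x powr q)" by simp
    qed
    show "AE y in lborel. (\<integral>\<^sup>+x. ?K x y * ennreal (?\<phi> x powr p) \<partial>lborel) \<le> ennreal (?C * ?\<phi> y powr p)"
      using AE_lborel_nonzero
    proof eventually_elim
      fix y :: 'a assume y: "y \<noteq> 0"
      have "(\<integral>\<^sup>+x. ?K x y * ennreal (?\<phi> x powr p) \<partial>lborel)
          = (\<integral>\<^sup>+x. riesz_kernel s (y - x) * ennreal (norm x powr (n / p - s - n)) \<partial>lborel)"
      proof (rule nn_integral_cong)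
        fix x :: 'a
        have "ennreal (norm x powr (- s)) * ennreal (?\<phi> x powr p) = ennreal (norm x powr (n / p - s - n))"
          unfolding \<phi>p by (simp add: ennreal_mult'[symmetric] powr_add[symmetric] algebra_simps)
        then show "?K x y * ennreal (?\<phi> x powr p) = riesz_kernel s (y - x) * ennreal (norm x powr (n / p - s - n))"
          by (metis mult.assoc mult.commute riesz_kernel_minus_commute)
      qed
      also have "\<dots> = ennreal (riesz_const n (s + (n / p - s)) / riesz_const n (n / p - s)
          * norm y powr (s + (n / p - s) - n))"
        unfolding n_def by (rule riesz_potential_of_power) (use s p np y in \<open>auto simp: n_def\<close>)
      also have "\<dots> = ennreal (?C * ?\<phi> y powr p)"
        unfolding \<phi>p using riesz_const_quotients(2)[OF s p n] by simp
      finally show "(\<integral>\<^sup>+x. ?K x y * ennreal (?\<phi> x powr p) \<partial>lborel) \<le> ennreal (?C * ?\<phi> y powr p)" by simp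
    qed
    show "AE x in lborel. ennreal (norm x powr (- s) * u x) \<le> (\<integral>\<^sup>+y. ?K x y * ennreal (f y) \<partial>lborel)"
    proof (rule AE_I2)
      fix x :: 'a
      have "ennreal (norm x powr (- s) * u x) \<le> ennreal (norm x powr (- s)) * (\<integral>\<^sup>+y. riesz_kernel s (x - y) * ennreal (f y) \<partial>lborel)"
        using bound[of x] by (simp add: ennreal_mult' mult_left_mono)
      also have "\<dots> = (\<integral>\<^sup>+y. ?K x y * ennreal (f y) \<partial>lborel)"
        by (subst nn_integral_cmult[symmetric]) (simp_all add: mult_ac)
      finally show "ennreal (norm x powr (- s) * u x) \<le> (\<integral>\<^sup>+y. ?K x y * ennreal (f y) \<partial>lborel)" .
    qed
  qed (use p q C f u in auto)
qed

section \<open>Rapidly decreasing functions\<close>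

text \<open>
  Monomials are indexed here by lists of coordinates, because iterated partial derivatives are, and the Fourier transform
  exchanges the two.
\<close>

definition rapidly_decreasing :: "(real^'n::finite \<Rightarrow> complex) \<Rightarrow> bool" where
  "rapidly_decreasing f \<longleftrightarrow> (\<forall>js. bounded (range (\<lambda>x. prod_list (map (\<lambda>j. x $ j) js) *\<^sub>R f x)))"

lemma rapidly_decreasing_coord:
  assumes "rapidly_decreasing f"
  shows "rapidly_decreasing (\<lambda>x. (x $ j) *\<^sub>R f x)"
  unfolding rapidly_decreasing_def
proof
  fix js
  show "bounded (range (\<lambda>x. prod_list (map (\<lambda>j. x $ j) js) *\<^sub>R (x $ j) *\<^sub>R f x))"
    using assms[unfolded rapidly_decreasing_def, rule_format, of "j # js"] by (simp add: mult_ac)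
qed

lemma rapidly_decreasing_add:
  assumes "rapidly_decreasing f" "rapidly_decreasing g"
  shows "rapidly_decreasing (\<lambda>x. f x + g x)"
  unfolding rapidly_decreasing_def scaleR_add_right
proof
  fix js :: "'a list"
  show "bounded (range (\<lambda>x. prod_list (map (\<lambda>j. x $ j) js) *\<^sub>R f x + prod_list (map (\<lambda>j. x $ j) js) *\<^sub>R g x))"
    using assms unfolding rapidly_decreasing_def by (intro bounded_plus_comp) blast+
qed

text \<open>
  A product weight that is at least $|x|^2$ and whose inverse is integrable by the product structure
  of Lebesgue measure. It plays the role of a power of $1+|x|^2$.
\<close>

definition decay_weight :: "real^'n::finite \<Rightarrow> real" where
  "decay_weight x = (\<Prod>i\<in>UNIV. 1 + (x $ i)\<^sup>2)"

lemma decay_weight_ge_1: "1 \<le> decay_weight x"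
  unfolding decay_weight_def by (rule prod_ge_1) simp

text \<open>
  The weight is a polynomial: its factors are multiplied in one at a time, each by two multiplications with a coordinate and one addition.
\<close>

lemma rapidly_decreasing_decay_weight:
  assumes "rapidly_decreasing f"
  shows "rapidly_decreasing (\<lambda>x. decay_weight x *\<^sub>R f x)"
proof -
  have "rapidly_decreasing (\<lambda>x. (\<Prod>i\<in>A. 1 + (x $ i)\<^sup>2) *\<^sub>R f x)" if "finite A" for A
    using that
  proof induction
    case (insert j A)
    from insert.IH have "rapidly_decreasing (\<lambda>x. (\<Prod>i\<in>A. 1 + (x $ i)\<^sup>2) *\<^sub>R f x
       + (x $ j) *\<^sub>R (x $ j) *\<^sub>R (\<Prod>i\<in>A. 1 + (x $ i)\<^sup>2) *\<^sub>R f x)"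
      by (intro rapidly_decreasing_add rapidly_decreasing_coord)
    moreover have "(\<Prod>i\<in>A. 1 + (x $ i)\<^sup>2) *\<^sub>R f x + (x $ j) *\<^sub>R (x $ j) *\<^sub>R (\<Prod>i\<in>A. 1 + (x $ i)\<^sup>2) *\<^sub>R f x
       = (\<Prod>i\<in>insert j A. 1 + (x $ i)\<^sup>2) *\<^sub>R f x" for x
      using insert.hyps by (simp add: scaleR_add_left ring_distribs power2_eq_square mult.assoc)
    ultimately show ?case by simp
  qed (use assms in simp)
  then show ?thesis unfolding decay_weight_def by simp
qed

lemma rapidly_decreasing_bound:
  assumes "rapidly_decreasing f"
  obtains C where "0 \<le> C" "\<And>x. norm (f x) \<le> C / decay_weight x ^ m"
proof -
  have "rapidly_decreasing (\<lambda>x. decay_weight x ^ m *\<^sub>R f x)"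
  proof (induction m)
    case (Suc m)
    then show ?case using rapidly_decreasing_decay_weight[OF Suc] by (simp add: mult.assoc)
  qed (use assms in simp)
  from this[unfolded rapidly_decreasing_def, rule_format, of "[]"]
  obtain C where C: "\<And>x. norm (decay_weight x ^ m *\<^sub>R f x) \<le> C"
    unfolding bounded_iff by auto
  have pos: "0 < decay_weight x ^ m" for x :: "real^'a"
    using decay_weight_ge_1[of x] by simp
  have "0 \<le> C" using C[of 0] norm_ge_zero order_trans by blast
  moreover have "norm (f x) \<le> C / decay_weight x ^ m" for x
    using C[of x] pos[of x] by (simp add: pos_le_divide_eq mult.commute)
  ultimately show thesis by (rule that)
qed

lemma decay_weight_eq_Basis: "decay_weight x = (\<Prod>b\<in>Basis. 1 + (x \<bullet> b)\<^sup>2)"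
proof -
  have B: "(Basis :: (real^'a) set) = (\<lambda>i. axis i 1) ` UNIV"
    by (auto simp: Basis_vec_def)
  show ?thesis
    unfolding decay_weight_def B
    by (subst prod.reindex) (auto simp: inj_on_def axis_eq_axis inner_axis)
qed

lemma measurable_decay_weight [measurable]: "decay_weight \<in> borel_measurable borel"
  unfolding decay_weight_eq_Basis by measurable

lemma integrable_inverse_decay_weight: "integrable lborel (\<lambda>x :: real^'n::finite. 1 / decay_weight x)"
proof -
  have i: "integrable lborel (\<lambda>t::real. inverse (1 + t\<^sup>2))"
    using integrable_inverse_1_plus_square by (simp add: set_integrable_def)
  have fin: "(\<integral>\<^sup>+t. ennreal (inverse (1 + t\<^sup>2)) \<partial>lborel) < \<infinity>"
    using i by (subst nn_integral_eq_integral) (auto)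
  have "(\<integral>\<^sup>+x. ennreal (1 / decay_weight (x::real^'n)) \<partial>lborel)
     = (\<integral>\<^sup>+x. (\<Prod>b\<in>Basis. ennreal (inverse (1 + ((x::real^'n) \<bullet> b)\<^sup>2))) \<partial>lborel)"
    unfolding decay_weight_eq_Basis
    by (subst prod_ennreal) (simp_all add: inverse_eq_divide prod_dividef)
  also have "\<dots> = (\<Prod>b\<in>(Basis :: (real^'n) set). (\<integral>\<^sup>+t. ennreal (inverse (1 + t\<^sup>2)) \<partial>lborel))"
    by (rule nn_integral_lborel_prod) auto
  also have "\<dots> < \<infinity>"
    using fin by (simp add: power_less_top_ennreal)
  finally show ?thesis
    by (intro integrableI_nonneg)
       (use decay_weight_ge_1 in \<open>auto intro!: AE_I2 divide_nonneg_nonneg intro: order_trans[OF zero_le_one]\<close>)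
qed

lemma norm_power2_le_decay_weight: "(norm x)\<^sup>2 \<le> decay_weight x"
proof -
  have "(\<Sum>i\<in>A. (x $ i)\<^sup>2) \<le> (\<Prod>i\<in>A. 1 + (x $ i)\<^sup>2)" if "finite A" for A
    using that
  proof induction
    case (insert j A)
    have "1 \<le> (\<Prod>i\<in>A. 1 + (x $ i)\<^sup>2)" by (rule prod_ge_1) simp
    then have "(x $ j)\<^sup>2 * 1 \<le> (x $ j)\<^sup>2 * (\<Prod>i\<in>A. 1 + (x $ i)\<^sup>2)"
      by (intro mult_left_mono) auto
    then show ?case using insert by (simp add: ring_distribs)
  qed simp
  then show ?thesis
    by (simp add: decay_weight_def norm_vec_def L2_set_def sum_nonneg)
qed

lemma rapidly_decreasing_integrable_powr:
  fixes f :: "real^'n::finite \<Rightarrow> complex"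
  assumes f: "rapidly_decreasing f" and [measurable]: "f \<in> borel_measurable borel" and s: "0 \<le> s" and c: "0 \<le> c"
  shows "integrable lborel (\<lambda>x. complex_of_real ((c * norm x) powr s) * f x)"
proof -
  \<comment> \<open>$|x|^s\le$ \<open>decay_weight x ^ m\<close>; one further factor of the weight makes the bound integrable.\<close>
  obtain m where m: "s / 2 \<le> real m" using real_arch_simple by blast
  obtain C where C: "0 \<le> C" "\<And>x. norm (f x) \<le> C / decay_weight x ^ Suc m"
    using rapidly_decreasing_bound[OF f] by metis
  have "integrable lborel (\<lambda>x :: real^'n. (c powr s * C) * (1 / decay_weight x))"
    by (intro integrable_mult_right integrable_inverse_decay_weight)
  then show ?thesis
  proof (rule Bochner_Integration.integrable_bound)
    show "AE x in lborel. norm (complex_of_real ((c * norm x) powr s) * f x)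
      \<le> norm ((c powr s * C) * (1 / decay_weight x))"
    proof (rule AE_I2)
      fix x :: "real^'n"
      have w: "1 \<le> decay_weight x" by (rule decay_weight_ge_1)
      have "norm x powr s \<le> (decay_weight x powr (1 / 2)) powr s"
        using norm_power2_le_decay_weight[of x] w s
        by (intro powr_mono2) (auto simp: powr_half_sqrt real_le_rsqrt)
      also have "\<dots> \<le> decay_weight x powr real m"
        using w m by (simp add: powr_powr powr_mono)
      also have "\<dots> = decay_weight x ^ m"
        using w by (simp add: powr_realpow)
      finally have 1: "norm x powr s \<le> decay_weight x ^ m" .
      have "norm (complex_of_real ((c * norm x) powr s) * f x) = c powr s * norm x powr s * norm (f x)"
        using c by (simp add: norm_mult powr_mult)
      also have "\<dots> \<le> c powr s * decay_weight x ^ m * (C / decay_weight x ^ Suc m)"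
        using 1 C w by (intro mult_mono) auto
      also have "\<dots> = (c powr s * C) * (1 / decay_weight x)"
        using w by (simp add: field_simps)
      also have "\<dots> \<le> norm ((c powr s * C) * (1 / decay_weight x))"
        by (simp only: real_norm_def abs_ge_self)
      finally show "norm (complex_of_real ((c * norm x) powr s) * f x)
        \<le> norm ((c powr s * C) * (1 / decay_weight x))" .
    qed
  qed measurable
qed

lemma rapidly_decreasing_integrable:
  fixes f :: "real^'n::finite \<Rightarrow> complex"
  assumes f: "rapidly_decreasing f" and [measurable]: "f \<in> borel_measurable borel"
  shows "integrable lborel f"
proof -
  obtain C where C: "0 \<le> C" "\<And>x. norm (f x) \<le> C / decay_weight x ^ 1"
    using rapidly_decreasing_bound[OF f] by metis
  have "integrable lborel (\<lambda>x :: real^'n. C * (1 / decay_weight x))"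
    by (intro integrable_mult_right integrable_inverse_decay_weight)
  then show ?thesis
    by (rule Bochner_Integration.integrable_bound)
       (use C in \<open>auto intro!: AE_I2 intro: order_trans[OF _ abs_ge_self] simp del: abs_divide\<close>)
qed

section \<open>Schwartz functions and their Fourier transforms\<close>

lemma schwartz_foldr:
  assumes "g \<in> schwartz_space"
  shows "foldr partial_deriv js g \<in> schwartz_space"
proof -
  have "foldr partial_deriv ks (foldr partial_deriv js g) = foldr partial_deriv (ks @ js) g" for ks
    by simp
  then show ?thesis using assms unfolding schwartz_space_def mem_Collect_eq by metis
qed

lemma schwartz_differentiable: "g \<in> schwartz_space \<Longrightarrow> g differentiable_on UNIV"
  unfolding schwartz_space_def by (auto dest: spec[of _ "[]"])

lemma schwartz_continuous: "g \<in> schwartz_space \<Longrightarrow> continuous_on UNIV g"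
  by (intro differentiable_imp_continuous_on schwartz_differentiable)

lemma schwartz_measurable: "g \<in> schwartz_space \<Longrightarrow> g \<in> borel_measurable borel"
  by (intro borel_measurable_continuous_onI schwartz_continuous)

text \<open>
  The monomial of a list of coordinates has as exponents the multiplicities of the coordinates in the list.
\<close>

lemma schwartz_rapidly_decreasing:
  fixes g :: "real^'n::finite \<Rightarrow> complex"
  assumes "g \<in> schwartz_space"
  shows "rapidly_decreasing g"
  unfolding rapidly_decreasing_def
proof
  fix js :: "'n list"
  have "\<exists>k :: 'n \<Rightarrow> nat. \<forall>x :: real^'n. prod_list (map (\<lambda>j. x $ j) js) = (\<Prod>i\<in>UNIV. (x $ i) ^ k i)"
  proof (induction js)
    case Nil
    show ?case by (rule exI[of _ "\<lambda>_. 0"]) simp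
  next
    case (Cons j js)
    then obtain k :: "'n \<Rightarrow> nat" where k: "\<And>x. prod_list (map (\<lambda>j. x $ j) js) = (\<Prod>i\<in>UNIV. ((x :: real^'n) $ i) ^ k i)"
      by blast
    have "prod_list (map (\<lambda>j. x $ j) (j # js)) = (\<Prod>i\<in>UNIV. (x $ i) ^ (k(j := Suc (k j))) i)" for x :: "real^'n"
    proof -
      have "(\<Prod>i\<in>UNIV - {j}. (x $ i) ^ (k(j := Suc (k j))) i) = (\<Prod>i\<in>UNIV - {j}. (x $ i) ^ k i)"
        by (rule prod.cong) auto
      then show ?thesis
        using prod.remove[of UNIV j "\<lambda>i. (x $ i) ^ (k(j := Suc (k j))) i"]
          prod.remove[of UNIV j "\<lambda>i. (x $ i) ^ k i"] by (simp add: k mult.assoc del: fun_upd_apply) (simp add: mult.assoc)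
    qed
    then show ?case by blast
  qed
  then obtain k :: "'n \<Rightarrow> nat" where "\<And>x :: real^'n. prod_list (map (\<lambda>j. x $ j) js) = (\<Prod>i\<in>UNIV. (x $ i) ^ k i)"
    by blast
  then show "bounded (range (\<lambda>x. prod_list (map (\<lambda>j. x $ j) js) *\<^sub>R g x))"
    using assms unfolding schwartz_space_def by (auto dest: spec[of _ "[]"])
qed

lemma schwartz_integrable: "g \<in> schwartz_space \<Longrightarrow> integrable lborel g"
  by (intro rapidly_decreasing_integrable schwartz_rapidly_decreasing schwartz_measurable)

lemma has_vector_derivative_partial_deriv:
  fixes F :: "real^'n::finite \<Rightarrow> complex"
  assumes "F differentiable_on UNIV"
  shows "((\<lambda>t. F (x + t *\<^sub>R axis i 1)) has_vector_derivative partial_deriv i F (x + t *\<^sub>R axis i 1)) (at t)"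
proof -
  let ?e = "axis i 1 :: real^'n"
  let ?D = "partial_deriv i F (x + t *\<^sub>R ?e)"
  let ?h = "\<lambda>u. F ((x + t *\<^sub>R ?e) + u *\<^sub>R ?e)"
  have "F differentiable at ((x + t *\<^sub>R ?e) + 0 *\<^sub>R ?e)"
    using assms by (auto simp: differentiable_on_def)
  then have "?h differentiable at 0"
    by (rule differentiable_compose) (auto intro!: derivative_intros)
  then have "(?h has_vector_derivative ?D) (at 0)"
    unfolding partial_deriv_def by (simp add: vector_derivative_works[symmetric])
  then have "((?h \<circ> (\<lambda>s. s - t)) has_vector_derivative (1 *\<^sub>R ?D)) (at t)"
    by (intro vector_diff_chain_at) (auto intro!: derivative_eq_intros)
  moreover have "?h \<circ> (\<lambda>s. s - t) = (\<lambda>s. F (x + s *\<^sub>R ?e))"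
    by (auto simp: fun_eq_iff algebra_simps)
  ultimately show ?thesis by simp
qed

lemma partial_deriv_eqI:
  assumes "((\<lambda>t. F (x + t *\<^sub>R axis i 1)) has_vector_derivative D) (at 0)"
  shows "partial_deriv i F x = D"
  using assms unfolding partial_deriv_def by (rule vector_derivative_at)

text \<open>
  Integrating the fundamental theorem of calculus
  $F(x+e_i)-F(x)=\int_0^1\partial_iF(x+te_i)\,dt$ over all $x$ gives $0$ on the left, by
  translation invariance, and $\int\partial_iF$ on the right, by Fubini's theorem and translation invariance.
  This avoids splitting the space into a line and a hyperplane.
\<close>

lemma integral_partial_deriv_eq_0:
  fixes F :: "real^'n::finite \<Rightarrow> complex"
  assumes diff: "F differentiable_on UNIV" and cont: "continuous_on UNIV (partial_deriv i F)"
    and F: "integrable lborel F" and dF: "integrable lborel (partial_deriv i F)"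
  shows "(LINT x|lborel. partial_deriv i F x) = 0"
proof -
  let ?e = "axis i 1 :: real^'n" and ?D = "partial_deriv i F"
  have [measurable]: "?D \<in> borel_measurable borel" "F \<in> borel_measurable borel"
    using F dF by (auto simp: integrable_iff_bounded)
  have shift: "integrable lborel (\<lambda>x. G (v + x)) \<and> (LINT x|lborel. G (v + x)) = (LINT x|lborel. G x)"
    if "integrable lborel G" for G :: "real^'n \<Rightarrow> complex" and v
  proof -
    have [measurable]: "G \<in> borel_measurable borel" using that by (auto simp: integrable_iff_bounded)
    have "integrable (distr lborel borel ((+) v)) G" using that by (simp only: lborel_distr_plus)
    then have "integrable lborel (\<lambda>x. G (v + x))" by (simp add: integrable_distr_eq)
    moreover have "(LINT x|lborel. G x) = (LINT x|lborel. G (v + x))"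
      using integral_lborel_affine[of G 1 v] by simp
    ultimately show ?thesis by simp
  qed
  have "(LINT x|lborel. LINT t|lborel. indicator {0..1} t *\<^sub>R ?D (x + t *\<^sub>R ?e))
      = (LINT x|lborel. F (x + ?e) - F x)"
  proof (intro Bochner_Integration.integral_cong refl)
    fix x :: "real^'n"
    have "(LINT t|lborel. indicator {0..1} t *\<^sub>R ?D (x + t *\<^sub>R ?e)) = F (x + 1 *\<^sub>R ?e) - F (x + 0 *\<^sub>R ?e)"
    proof (rule integral_FTC_Icc)
      show "continuous_on {0..1} (\<lambda>t. ?D (x + t *\<^sub>R ?e))"
        by (intro continuous_on_compose2[OF cont] continuous_intros) auto
    qed (auto intro: has_vector_derivative_at_within has_vector_derivative_partial_deriv[OF diff])
    then show "(LINT t|lborel. indicator {0..1} t *\<^sub>R ?D (x + t *\<^sub>R ?e)) = F (x + ?e) - F x" by simp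
  qed
  also have "\<dots> = 0"
    using shift[OF F, of ?e] F by (simp add: add.commute)
  finally have 0: "(LINT x|lborel. LINT t|lborel. indicator {0..1} t *\<^sub>R ?D (x + t *\<^sub>R ?e)) = 0" .
  have 1: "(LINT t|lborel. LINT x|lborel. indicator {0..1} t *\<^sub>R ?D (x + t *\<^sub>R ?e))
      = (LINT x|lborel. LINT t|lborel. indicator {0..1} t *\<^sub>R ?D (x + t *\<^sub>R ?e))"
  proof (rule Fubini_lborel)
    have "(\<integral>\<^sup>+t. (\<integral>\<^sup>+x. ennreal (norm (indicator {0..1} t *\<^sub>R ?D (x + t *\<^sub>R ?e))) \<partial>lborel) \<partial>lborel)
       = (\<integral>\<^sup>+t. (\<integral>\<^sup>+x. ennreal (norm (?D x)) \<partial>lborel) * indicator {0..1::real} t \<partial>lborel)"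
    proof (rule nn_integral_cong)
      fix t :: real
      have "(\<integral>\<^sup>+x. ennreal (norm (?D (t *\<^sub>R ?e + x))) \<partial>lborel) = (\<integral>\<^sup>+x. ennreal (norm (?D x)) \<partial>lborel)"
        by (rule nn_integral_lborel_translation) measurable
      then show "(\<integral>\<^sup>+x. ennreal (norm (indicator {0..1} t *\<^sub>R ?D (x + t *\<^sub>R ?e))) \<partial>lborel)
         = (\<integral>\<^sup>+x. ennreal (norm (?D x)) \<partial>lborel) * indicator {0..1} t"
        by (auto simp: add.commute split: split_indicator)
    qed
    also have "\<dots> = (\<integral>\<^sup>+x. ennreal (norm (?D x)) \<partial>lborel)"
      by (subst nn_integral_cmult_indicator) auto
    also have "\<dots> < \<infinity>" using dF by (simp add: integrable_iff_bounded)
    finally show "(\<integral>\<^sup>+t. (\<integral>\<^sup>+x. ennreal (norm (indicator {0..1} t *\<^sub>R ?D (x + t *\<^sub>R ?e))) \<partial>lborel) \<partial>lborel) < \<infinity>" .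
  qed measurable
  have "(LINT x|lborel. ?D (x + v)) = (LINT x|lborel. ?D x)" for v
    using shift[OF dF, of v] by (simp only: add.commute[of _ v])
  then have "(LINT t|lborel. LINT x|lborel. indicator {0..1} t *\<^sub>R ?D (x + t *\<^sub>R ?e))
     = (LINT t|lborel. indicator {0..1::real} t *\<^sub>R (LINT x|lborel. ?D x))"
    by (intro Bochner_Integration.integral_cong refl) simp
  also have "\<dots> = (LINT x|lborel. ?D x)"
    by (subst integral_scaleR_left) auto
  finally show ?thesis using 0 1 by simp
qed

abbreviation phase :: "'a::euclidean_space \<Rightarrow> 'a \<Rightarrow> complex" where
  "phase x y \<equiv> exp (2 * pi * \<i> * (x \<bullet> y))"

abbreviation phase_inv :: "'a::euclidean_space \<Rightarrow> 'a \<Rightarrow> complex" where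
  "phase_inv x y \<equiv> exp (- 2 * pi * \<i> * (x \<bullet> y))"

lemma phase_differentiable: "(\<lambda>x. phase x y) differentiable_on UNIV"
proof -
  have "(\<lambda>x. phase x y) = (\<lambda>x. cis (2 * pi * (x \<bullet> y)))"
    by (simp add: cis_conv_exp mult_ac)
  moreover have "(\<lambda>x. cis (2 * pi * (x \<bullet> y))) differentiable_on UNIV"
    unfolding differentiable_on_def differentiable_def
    by (auto intro!: derivative_eq_intros exI)
  ultimately show ?thesis by simp
qed

lemma integrable_phase_mult:
  fixes g :: "'a::euclidean_space \<Rightarrow> complex"
  assumes "integrable lborel g"
  shows "integrable lborel (\<lambda>x. phase x y * g x)"
proof -
  have [measurable]: "g \<in> borel_measurable borel" using assms by (auto simp: integrable_iff_bounded)
  show ?thesis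
    by (rule Bochner_Integration.integrable_bound[OF assms]) (auto simp: norm_mult)
qed

text \<open>
  Integration by parts, in the form that the derivative of $e^{2\pi ix\cdot y}g(x)$ integrates to zero.
\<close>

lemma fourier_partial_deriv:
  fixes g :: "real^'n::finite \<Rightarrow> complex"
  assumes g: "g \<in> schwartz_space"
  shows "fourier (partial_deriv i g) y = - (2 * pi * \<i> * (y $ i)) * fourier g y"
proof -
  let ?c = "2 * pi * \<i> * (y $ i)"
  have dg: "partial_deriv i g \<in> schwartz_space"
    using schwartz_foldr[OF g, of "[i]"] by simp
  have D: "partial_deriv i (\<lambda>x. phase x y * g x) x = ?c * (phase x y * g x) + phase x y * partial_deriv i g x" for x
  proof (rule partial_deriv_eqI)
    have "((\<lambda>t. g (x + t *\<^sub>R axis i 1)) has_vector_derivative partial_deriv i g x) (at 0)"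
      using has_vector_derivative_partial_deriv[OF schwartz_differentiable[OF g], where x=x and t=0 and i=i] by simp
    moreover have "((\<lambda>t. phase (x + t *\<^sub>R axis i 1) y) has_vector_derivative ?c * phase x y) (at 0)"
    proof -
      have e: "(x + t *\<^sub>R axis i 1) \<bullet> y = x \<bullet> y + t * (y $ i)" for t
        by (simp add: inner_add_left inner_axis')
      have "(\<lambda>t. phase (x + t *\<^sub>R axis i 1) y) = (\<lambda>t. phase x y * exp (t *\<^sub>R ?c))"
        unfolding e by (simp add: fun_eq_iff ring_distribs scaleR_conv_of_real mult_ac flip: exp_add)
      then show ?thesis
        using has_vector_derivative_mult_right[OF exp_scaleR_has_vector_derivative_right[of ?c 0 UNIV], of "phase x y"]
        by (simp add: mult_ac)
    qed
    ultimately show "((\<lambda>t. phase (x + t *\<^sub>R axis i 1) y * g (x + t *\<^sub>R axis i 1)) has_vector_derivative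
        ?c * (phase x y * g x) + phase x y * partial_deriv i g x) (at 0)"
      by (auto intro!: derivative_eq_intros)
  qed
  have i1: "integrable lborel (\<lambda>x. phase x y * g x)" and i2: "integrable lborel (\<lambda>x. phase x y * partial_deriv i g x)"
    by (intro integrable_phase_mult schwartz_integrable g dg)+
  have "(LINT x|lborel. partial_deriv i (\<lambda>x. phase x y * g x) x) = 0"
  proof (rule integral_partial_deriv_eq_0)
    show "(\<lambda>x. phase x y * g x) differentiable_on UNIV"
      unfolding differentiable_on_def
    proof (intro ballI Deriv.differentiable_mult)
      fix x :: "real^'n"
      show "(\<lambda>x. phase x y) differentiable at x within UNIV" "g differentiable at x within UNIV"
        using phase_differentiable[of y] schwartz_differentiable[OF g]
        unfolding differentiable_on_def by blast+
    qed
    show "continuous_on UNIV (partial_deriv i (\<lambda>x. phase x y * g x))"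
      unfolding D using schwartz_continuous[OF g] schwartz_continuous[OF dg]
      by (intro continuous_intros)
    show "integrable lborel (partial_deriv i (\<lambda>x. phase x y * g x))"
      unfolding D using i1 i2 by auto
  qed (fact i1)
  then have "?c * fourier g y + fourier (partial_deriv i g) y = 0"
    unfolding D using i1 i2 by (simp add: fourier_def)
  then show ?thesis by (simp add: eq_neg_iff_add_eq_0 add.commute)
qed

lemma fourier_foldr_partial_deriv:
  fixes g :: "real^'n::finite \<Rightarrow> complex"
  assumes "g \<in> schwartz_space"
  shows "fourier (foldr partial_deriv js g) y
    = (- 2 * pi * \<i>) ^ length js * complex_of_real (prod_list (map (\<lambda>j. y $ j) js)) * fourier g y"
  by (induction js)
     (simp_all add: fourier_partial_deriv schwartz_foldr[OF assms] mult_ac)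

lemma norm_fourier_le:
  fixes g :: "real^'n::finite \<Rightarrow> complex"
  shows "norm (fourier g y) \<le> (LINT x|lborel. norm (g x))"
  unfolding fourier_def
  by (rule order_trans[OF integral_norm_bound]) (simp add: norm_mult)

text \<open>
  A monomial in $y$ times $\hat g$ is, up to a constant, the Fourier transform of an integrable derivative of $g$, hence bounded.
\<close>

lemma fourier_rapidly_decreasing:
  fixes g :: "real^'n::finite \<Rightarrow> complex"
  assumes g: "g \<in> schwartz_space"
  shows "rapidly_decreasing (fourier g)"
  unfolding rapidly_decreasing_def
proof
  fix js :: "'n list"
  let ?C = "LINT x|lborel. norm (foldr partial_deriv js g x)"
  have "norm (prod_list (map (\<lambda>j. y $ j) js) *\<^sub>R fourier g y) \<le> ?C / (2 * pi) ^ length js" for y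
  proof -
    have "(2 * pi) ^ length js * norm (prod_list (map (\<lambda>j. y $ j) js) *\<^sub>R fourier g y)
        = norm (fourier (foldr partial_deriv js g) y)"
      by (simp add: fourier_foldr_partial_deriv[OF g] norm_mult norm_power)
    also have "\<dots> \<le> ?C" by (rule norm_fourier_le)
    finally show ?thesis by (simp add: pos_le_divide_eq mult.commute)
  qed
  then show "bounded (range (\<lambda>y. prod_list (map (\<lambda>j. y $ j) js) *\<^sub>R fourier g y))"
    unfolding bounded_iff by blast
qed

lemma measurable_fourier [measurable]:
  assumes [measurable]: "g \<in> borel_measurable borel"
  shows "fourier g \<in> borel_measurable borel"
  unfolding fourier_def by measurable

lemma measurable_inverse_fourier [measurable]:
  assumes [measurable]: "g \<in> borel_measurable borel"
  shows "inverse_fourier g \<in> borel_measurable borel"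
  unfolding inverse_fourier_def by measurable

section \<open>Fourier inversion\<close>

text \<open>
  A Gaussian multiplier is itself a multiple of a heat kernel, at the dual time $1/(16\pi^2t)$, so the
  Fourier transform of heat kernels also computes the transform of Gaussian multipliers.
\<close>

lemma gaussian_eq_heat_kernel:
  fixes y :: "'a::euclidean_space"
  assumes t: "0 < t"
  shows "exp (- (4 * pi\<^sup>2 * t * (norm y)\<^sup>2))
    = (4 * pi * t) powr (- real DIM('a) / 2) * heat_kernel (1 / (16 * pi\<^sup>2 * t)) y"
proof -
  define u where "u = 1 / (16 * pi\<^sup>2 * t)"
  define c where "c = (4 * pi * t) powr (- real DIM('a) / 2)"
  have u: "0 < u" and c: "c \<noteq> 0" using t by (simp_all add: u_def c_def)
  have "4 * pi * u = inverse (4 * pi * t)"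
    using t by (simp add: u_def field_simps power2_eq_square)
  then have "(4 * pi * u) powr (- real DIM('a) / 2) = inverse c"
    using t by (simp only: inverse_powr c_def)
  moreover have "- (norm y)\<^sup>2 / (4 * u) = - (4 * pi\<^sup>2 * t * (norm y)\<^sup>2)"
    using t by (simp add: u_def field_simps)
  ultimately have "heat_kernel u y = inverse c * exp (- (4 * pi\<^sup>2 * t * (norm y)\<^sup>2))"
    by (simp only: heat_kernel_eq[OF u])
  then show ?thesis
    unfolding u_def[symmetric] c_def[symmetric] using c by simp
qed

text \<open>
  The heat kernel recovered from its multiplier: Fourier inversion for Gaussians, from which the general
  inversion formula is deduced.
\<close>

lemma heat_kernel_duality:
  fixes x :: "'a::euclidean_space"
  assumes t: "0 < t"
  shows "(LINT y|lborel. exp (\<i> * of_real (2 * pi * (y \<bullet> x))) * of_real (exp (- (4 * pi\<^sup>2 * t * (norm y)\<^sup>2))))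
     = of_real (heat_kernel t x)"
proof -
  define u where "u = 1 / (16 * pi\<^sup>2 * t)"
  have u: "0 < u" using t by (simp add: u_def)
  define c where "c = (4 * pi * t) powr (- real DIM('a) / 2)"
  have e1: "exp (- (4 * pi\<^sup>2 * t * (norm y)\<^sup>2)) = c * heat_kernel u y" for y :: 'a
    unfolding c_def u_def by (rule gaussian_eq_heat_kernel[OF t])
  have "(LINT y|lborel. exp (\<i> * of_real (2 * pi * (y \<bullet> x))) * of_real (exp (- (4 * pi\<^sup>2 * t * (norm y)\<^sup>2))))
     = (LINT y|lborel. of_real c * (exp (\<i> * of_real (2 * pi * (y \<bullet> x))) * of_real (heat_kernel u y)))"
    unfolding e1 by (simp add: mult_ac)
  also have "\<dots> = of_real c * exp (- of_real (4 * pi\<^sup>2 * u * (norm x)\<^sup>2))"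
    using heat_kernel_fourier[OF u, of x] by simp
  also have "\<dots> = of_real (c * exp (- (4 * pi\<^sup>2 * u * (norm x)\<^sup>2)))"
    by (simp flip: exp_of_real)
  also have "4 * pi\<^sup>2 * u * (norm x)\<^sup>2 = (norm x)\<^sup>2 / (4 * t)"
    using t by (simp add: u_def field_simps)
  also have "c * exp (- ((norm x)\<^sup>2 / (4 * t))) = heat_kernel t x"
    using t by (simp add: heat_kernel_eq c_def)
  finally show ?thesis .
qed

text \<open>
  $e^{t\Delta}$ acts on the inverse transform of an integrable $h$ as its multiplier. The integrals over
  space and frequency may be exchanged because both the heat kernel and $h$ are integrable.
\<close>

lemma heat_kernel_convolution_inverse_fourier:
  fixes h :: "real^'n::finite \<Rightarrow> complex"
  assumes t: "0 < t" and h: "integrable lborel h"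
  shows "(LINT z|lborel. of_real (heat_kernel t (x - z)) * inverse_fourier h z)
    = (LINT y|lborel. of_real (exp (- (4 * pi\<^sup>2 * t * (norm y)\<^sup>2))) * (phase_inv x y * h y))"
proof -
  have [measurable]: "h \<in> borel_measurable borel" using h by (auto simp: integrable_iff_bounded)
  have "(LINT z|lborel. of_real (heat_kernel t (x - z)) * inverse_fourier h z)
     = (LINT z|lborel. LINT y|lborel. of_real (heat_kernel t (x - z)) * (phase_inv z y * h y))"
    unfolding inverse_fourier_def by simp
  also have "\<dots> = (LINT y|lborel. LINT z|lborel. of_real (heat_kernel t (x - z)) * (phase_inv z y * h y))"
  proof (rule Fubini_lborel)
    have "(\<integral>\<^sup>+z. (\<integral>\<^sup>+y. ennreal (norm (of_real (heat_kernel t (x - z)) * (phase_inv z y * h y))) \<partial>lborel) \<partial>lborel)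
       = (\<integral>\<^sup>+z. ennreal (heat_kernel t (- x + z)) * (\<integral>\<^sup>+y. ennreal (norm (h y)) \<partial>lborel) \<partial>lborel)"
      by (simp add: norm_mult ennreal_mult nn_integral_cmult heat_kernel_minus_commute[of t x])
    also have "\<dots> = (\<integral>\<^sup>+z. ennreal (heat_kernel t z) * (\<integral>\<^sup>+y. ennreal (norm (h y)) \<partial>lborel) \<partial>(lborel :: (real^'n) measure))"
      by (rule nn_integral_lborel_translation) measurable
    also have "\<dots> = (\<integral>\<^sup>+y. ennreal (norm (h y)) \<partial>lborel)"
      by (simp add: nn_integral_multc nn_integral_heat_kernel[OF t])
    also have "\<dots> < \<infinity>" using h by (simp add: integrable_iff_bounded)
    finally show "(\<integral>\<^sup>+z. (\<integral>\<^sup>+y. ennreal (norm (of_real (heat_kernel t (x - z)) * (phase_inv z y * h y))) \<partial>lborel) \<partial>lborel) < \<infinity>" .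
  qed measurable
  also have "\<dots> = (LINT y|lborel. of_real (exp (- (4 * pi\<^sup>2 * t * (norm y)\<^sup>2))) * (phase_inv x y * h y))"
  proof (intro Bochner_Integration.integral_cong refl)
    fix y :: "real^'n"
    have "(LINT z|lborel. of_real (heat_kernel t (x - z)) * (phase_inv z y * h y))
       = (LINT z|lborel. (of_real (heat_kernel t (x - z)) * phase_inv z y) * h y)"
      by (simp add: mult_ac)
    also have "\<dots> = (LINT z|lborel. of_real (heat_kernel t (x - z)) * phase_inv z y) * h y"
      by (rule integral_mult_left_zero)
    \<comment> \<open>The reflection $z = x - w$ centres the Gaussian and splits off the phase at $x$.\<close>
    also have "(LINT z|lborel. of_real (heat_kernel t (x - z)) * phase_inv z y)
       = (LINT w|lborel. of_real (heat_kernel t (x - (x + (-1) *\<^sub>R w))) * phase_inv (x + (-1) *\<^sub>R w) y)"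
      by (subst integral_lborel_affine[of _ "-1" x]) auto
    also have "\<dots> = (LINT w|lborel. phase_inv x y * (exp (\<i> * of_real (2 * pi * (w \<bullet> y))) * of_real (heat_kernel t w)))"
      by (intro Bochner_Integration.integral_cong refl)
         (simp add: inner_diff_left ring_distribs mult_ac exp_diff exp_minus divide_simps)
    also have "\<dots> = phase_inv x y * exp (- of_real (4 * pi\<^sup>2 * t * (norm y)\<^sup>2))"
      using heat_kernel_fourier[OF t, of y] by simp
    finally show "(LINT z|lborel. of_real (heat_kernel t (x - z)) * (phase_inv z y * h y))
       = of_real (exp (- (4 * pi\<^sup>2 * t * (norm y)\<^sup>2))) * (phase_inv x y * h y)"
      by (simp add: mult_ac flip: exp_of_real)
  qed
  finally show ?thesis .
qed

text \<open>
  Inserting a Gaussian makes the double integral in the inversion formula absolutely convergent; exchanging the integrals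
  leaves the average of $g$ against the heat kernel centred at $x$.
\<close>

lemma heat_regularised_inversion:
  fixes g :: "real^'n::finite \<Rightarrow> complex"
  assumes t: "0 < t" and g: "integrable lborel g"
  shows "(LINT y|lborel. of_real (exp (- (4 * pi\<^sup>2 * t * (norm y)\<^sup>2))) * (phase_inv x y * fourier g y))
    = (LINT z|lborel. of_real (heat_kernel t (z - x)) * g z)"
proof -
  have [measurable]: "g \<in> borel_measurable borel" using g by (auto simp: integrable_iff_bounded)
  let ?G = "\<lambda>y::real^'n. exp (- (4 * pi\<^sup>2 * t * (norm y)\<^sup>2))"
  have G: "(\<integral>\<^sup>+y. ennreal (?G y) \<partial>lborel) < \<infinity>"
  proof -
    have "(\<integral>\<^sup>+y. ennreal (?G y) \<partial>lborel) = ennreal ((4 * pi * t) powr (- real DIM(real^'n) / 2))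
        * (\<integral>\<^sup>+y. ennreal (heat_kernel (1 / (16 * pi\<^sup>2 * t)) (y::real^'n)) \<partial>lborel)"
      unfolding gaussian_eq_heat_kernel[OF t]
      by (subst nn_integral_cmult[symmetric]) (auto simp: ennreal_mult)
    also have "\<dots> = ennreal ((4 * pi * t) powr (- real DIM(real^'n) / 2))"
      using t by (subst nn_integral_heat_kernel) auto
    finally show ?thesis by simp
  qed
  have "(LINT y|lborel. of_real (?G y) * (phase_inv x y * fourier g y))
     = (LINT y|lborel. LINT z|lborel. of_real (?G y) * (phase_inv x y * (phase z y * g z)))"
    unfolding fourier_def by simp
  also have "\<dots> = (LINT z|lborel. LINT y|lborel. of_real (?G y) * (phase_inv x y * (phase z y * g z)))"
  proof (rule Fubini_lborel)
    have "(\<integral>\<^sup>+y. (\<integral>\<^sup>+z. ennreal (norm (of_real (?G y) * (phase_inv x y * (phase z y * g z)))) \<partial>lborel) \<partial>lborel)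
       = (\<integral>\<^sup>+y. ennreal (?G y) \<partial>lborel) * (\<integral>\<^sup>+z. ennreal (norm (g z)) \<partial>lborel)"
      by (simp add: norm_mult ennreal_mult nn_integral_cmult nn_integral_multc)
    also have "\<dots> < \<infinity>" using G g by (simp add: integrable_iff_bounded ennreal_mult_less_top)
    finally show "(\<integral>\<^sup>+y. (\<integral>\<^sup>+z. ennreal (norm (of_real (?G y) * (phase_inv x y * (phase z y * g z)))) \<partial>lborel) \<partial>lborel) < \<infinity>" .
  qed measurable
  also have "\<dots> = (LINT z|lborel. of_real (heat_kernel t (z - x)) * g z)"
  proof (intro Bochner_Integration.integral_cong refl)
    fix z :: "real^'n"
    have "(LINT y|lborel. of_real (?G y) * (phase_inv x y * (phase z y * g z)))
       = (LINT y|lborel. (exp (\<i> * of_real (2 * pi * (y \<bullet> (z - x)))) * of_real (?G y)) * g z)"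
    proof (intro Bochner_Integration.integral_cong refl)
      fix y :: "real^'n"
      have e: "phase_inv x y * phase z y = exp (\<i> * of_real (2 * pi * (y \<bullet> (z - x))))"
        unfolding exp_add[symmetric]
        by (rule arg_cong[where f=exp]) (simp add: inner_diff_right inner_commute algebra_simps)
      have "of_real (?G y) * (phase_inv x y * (phase z y * g z)) = (phase_inv x y * phase z y) * of_real (?G y) * g z"
        by (simp only: mult_ac)
      then show "of_real (?G y) * (phase_inv x y * (phase z y * g z))
          = (exp (\<i> * of_real (2 * pi * (y \<bullet> (z - x)))) * of_real (?G y)) * g z"
        by (simp only: e)
    qed
    also have "\<dots> = of_real (heat_kernel t (z - x)) * g z"
      by (subst integral_mult_left_zero, subst heat_kernel_duality[OF t]) simp
    finally show "(LINT y|lborel. of_real (?G y) * (phase_inv x y * (phase z y * g z)))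
       = of_real (heat_kernel t (z - x)) * g z" .
  qed
  finally show ?thesis .
qed

text \<open>
  Parabolic scaling: time scales as the square of length.
\<close>

lemma heat_kernel_scale:
  fixes w :: "'a::euclidean_space"
  assumes c: "0 < c"
  shows "c ^ DIM('a) * heat_kernel (c\<^sup>2) (c *\<^sub>R w) = heat_kernel 1 w"
proof -
  have "(4 * pi * c\<^sup>2) powr (- real DIM('a) / 2) = (4 * pi) powr (- real DIM('a) / 2) * (c powr 2) powr (- real DIM('a) / 2)"
    using c by (simp add: powr_mult)
  also have "(c powr 2) powr (- real DIM('a) / 2) = inverse (c ^ DIM('a))"
    using c by (simp only: powr_powr) (simp add: powr_minus powr_realpow)
  finally show ?thesis
    using c by (simp add: heat_kernel_eq power_mult_distrib)
qed

text \<open>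
  After rescaling, the heat kernel at time $1/(m+1)^2$ becomes the fixed kernel at time $1$ and the argument of $g$ contracts to $x$;
  dominated convergence then applies.
\<close>

lemma heat_approximate_identity:
  fixes g :: "real^'n::finite \<Rightarrow> complex"
  assumes cont: "continuous_on UNIV g" and bd: "\<And>x. norm (g x) \<le> M"
  shows "(\<lambda>m. LINT z|lborel. of_real (heat_kernel ((1 / real (Suc m))\<^sup>2) (z - x)) * g z) \<longlonglongrightarrow> g x"
proof -
  have [measurable]: "g \<in> borel_measurable borel" by (rule borel_measurable_continuous_onI[OF cont])
  have "(LINT z|lborel. of_real (heat_kernel ((1 / real (Suc m))\<^sup>2) (z - x)) * g z)
     = (LINT w|lborel. of_real (heat_kernel 1 w) * g (x + (1 / real (Suc m)) *\<^sub>R w))" for m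
  proof -
    let ?c = "1 / real (Suc m)"
    have c: "0 < ?c" by simp
    have "(LINT z|lborel. of_real (heat_kernel (?c\<^sup>2) (z - x)) * g z)
       = (LINT w|lborel. (\<bar>?c\<bar> ^ DIM(real^'n)) *\<^sub>R (of_real (heat_kernel (?c\<^sup>2) (x + ?c *\<^sub>R w - x)) * g (x + ?c *\<^sub>R w)))"
      by (rule integral_lborel_affine) auto
    also have "\<dots> = (LINT w|lborel. of_real (?c ^ DIM(real^'n) * heat_kernel (?c\<^sup>2) (?c *\<^sub>R w)) * g (x + ?c *\<^sub>R w))"
      by (simp add: scaleR_conv_of_real mult_ac)
    finally show ?thesis unfolding heat_kernel_scale[OF c] .
  qed
  moreover have "(\<lambda>m. LINT w|lborel. of_real (heat_kernel 1 w) * g (x + (1 / real (Suc m)) *\<^sub>R w))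
      \<longlonglongrightarrow> (LINT w|lborel. of_real (heat_kernel 1 (w :: real^'n)) * g x)"
  proof (rule integral_dominated_convergence[where w="\<lambda>w. heat_kernel 1 w * M"])
    show "integrable lborel (\<lambda>w :: real^'n. heat_kernel 1 w * M)"
      by (intro integrable_mult_left integrable_heat_kernel) simp
    show "AE w in lborel. (\<lambda>m. of_real (heat_kernel 1 w) * g (x + (1 / real (Suc m)) *\<^sub>R w)) \<longlonglongrightarrow> of_real (heat_kernel 1 w) * g x"
    proof (intro AE_I2 tendsto_mult tendsto_const)
      fix w :: "real^'n"
      have "(\<lambda>m. x + (1 / real (Suc m)) *\<^sub>R w) \<longlonglongrightarrow> x + 0 *\<^sub>R w"
        by (intro tendsto_intros LIMSEQ_Suc[OF lim_1_over_n])
      moreover have "isCont g x" using cont by (simp add: continuous_on_eq_continuous_at)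
      ultimately show "(\<lambda>m. g (x + (1 / real (Suc m)) *\<^sub>R w)) \<longlonglongrightarrow> g x"
        using isCont_tendsto_compose[of x g "\<lambda>m. x + (1 / real (Suc m)) *\<^sub>R w"] by simp
    qed
    show "AE w in lborel. norm (of_real (heat_kernel 1 w) * g (x + (1 / real (Suc m)) *\<^sub>R w)) \<le> heat_kernel 1 w * M" for m
      using bd by (auto simp: norm_mult intro!: mult_left_mono)
  qed auto
  moreover have "(LINT w|lborel. complex_of_real (heat_kernel 1 (w :: real^'n)) * g x) = g x"
  proof -
    have "(LINT w|lborel. heat_kernel 1 (w :: real^'n)) = 1"
      using nn_integral_heat_kernel[of 1, where 'a="real^'n"]
      by (subst integral_eq_nn_integral) auto
    then show ?thesis by simp
  qed
  ultimately show ?thesis by (simp only:)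
qed

lemma fourier_integrable_powr:
  fixes g :: "real^'n::finite \<Rightarrow> complex"
  assumes "g \<in> schwartz_space" "0 \<le> s"
  shows "integrable lborel (\<lambda>y. complex_of_real ((2 * pi * norm y) powr s) * fourier g y)"
  using assms by (intro rapidly_decreasing_integrable_powr fourier_rapidly_decreasing measurable_fourier schwartz_measurable) auto

lemma fourier_integrable:
  fixes g :: "real^'n::finite \<Rightarrow> complex"
  assumes "g \<in> schwartz_space"
  shows "integrable lborel (fourier g)"
  using assms by (intro rapidly_decreasing_integrable fourier_rapidly_decreasing measurable_fourier schwartz_measurable) auto

text \<open>
  The Gaussian-regularised integrals converge to the inversion integral by dominated convergence, as $\hat g$ is integrable,
  and to $g(x)$ because heat kernels are an approximate identity.
\<close>

theorem fourier_inversion: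
  fixes g :: "real^'n::finite \<Rightarrow> complex"
  assumes g: "g \<in> schwartz_space"
  shows "inverse_fourier (fourier g) x = g x"
proof (rule LIMSEQ_unique)
  have [measurable]: "fourier g \<in> borel_measurable borel"
    using g by (intro measurable_fourier schwartz_measurable)
  let ?I = "\<lambda>m. LINT y|lborel. of_real (exp (- (4 * pi\<^sup>2 * (1 / real (Suc m))\<^sup>2 * (norm y)\<^sup>2))) * (phase_inv x y * fourier g y)"
  obtain M where M: "\<And>x. norm (g x) \<le> M"
    using rapidly_decreasing_bound[OF schwartz_rapidly_decreasing[OF g], of 0] by auto
  have "?I m = (LINT z|lborel. of_real (heat_kernel ((1 / real (Suc m))\<^sup>2) (z - x)) * g z)" for m
    by (rule heat_regularised_inversion) (auto intro: schwartz_integrable g)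
  then show "?I \<longlonglongrightarrow> g x"
    using heat_approximate_identity[OF schwartz_continuous[OF g] M, of x] by simp
  show "?I \<longlonglongrightarrow> inverse_fourier (fourier g) x"
    unfolding inverse_fourier_def
  proof (rule integral_dominated_convergence[where w="\<lambda>y. norm (fourier g y)"])
    show "AE y in lborel. (\<lambda>m. of_real (exp (- (4 * pi\<^sup>2 * (1 / real (Suc m))\<^sup>2 * (norm y)\<^sup>2))) * (phase_inv x y * fourier g y))
        \<longlonglongrightarrow> phase_inv x y * fourier g y"
    proof (rule AE_I2)
      fix y :: "real^'n"
      have "(\<lambda>m. complex_of_real (exp (- (4 * pi\<^sup>2 * (1 / real (Suc m))\<^sup>2 * (norm y)\<^sup>2))) * (phase_inv x y * fourier g y))
          \<longlonglongrightarrow> of_real (exp (- (4 * pi\<^sup>2 * 0\<^sup>2 * (norm y)\<^sup>2))) * (phase_inv x y * fourier g y)"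
        by (intro tendsto_intros LIMSEQ_Suc[OF lim_1_over_n])
      then show "(\<lambda>m. complex_of_real (exp (- (4 * pi\<^sup>2 * (1 / real (Suc m))\<^sup>2 * (norm y)\<^sup>2))) * (phase_inv x y * fourier g y))
          \<longlonglongrightarrow> phase_inv x y * fourier g y" by simp
    qed
    show "AE y in lborel. norm (of_real (exp (- (4 * pi\<^sup>2 * (1 / real (Suc m))\<^sup>2 * (norm y)\<^sup>2))) * (phase_inv x y * fourier g y))
       \<le> norm (fourier g y)" for m
      by (auto simp: norm_mult intro!: AE_I2 mult_left_le_one_le)
  qed (use fourier_integrable[OF g] in auto)
qed

section \<open>Recovering a function from its fractional Laplacian\<close>

text \<open>
  The Gamma integral expresses $(2\pi|y|)^{-s}$ as a superposition of the heat multipliers $e^{-4\pi^2t|y|^2}$.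
\<close>

lemma heat_subordination:
  fixes y :: "'a::euclidean_space"
  assumes s: "0 < s" and y: "y \<noteq> 0"
  shows "(\<integral>\<^sup>+t. ennreal (gamma_weight (s / 2) t * exp (- (4 * pi\<^sup>2 * t * (norm y)\<^sup>2))) \<partial>lborel)
    = ennreal ((2 * pi * norm y) powr (- s))"
proof -
  have "(\<integral>\<^sup>+t. ennreal (gamma_weight (s / 2) t * exp (- (2 * pi * norm y)\<^sup>2 * t)) \<partial>lborel)
      = ennreal ((2 * pi * norm y)\<^sup>2 powr (- (s / 2)))"
    using s y by (intro nn_integral_gamma_weight_exp) auto
  also have "(2 * pi * norm y)\<^sup>2 = (2 * pi * norm y) powr 2"
    using y by simp
  also have "((2 * pi * norm y) powr 2) powr (- (s / 2)) = (2 * pi * norm y) powr (- s)"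
    by (simp only: powr_powr) simp
  finally show ?thesis by (simp add: power_mult_distrib mult_ac)
qed

text \<open>
  With $f=(-\Delta)^{s/2}g$, the identity $g=(-\Delta)^{-s/2}f$ holds as an iterated integral over $t$
  and then over space: in Fourier variables the subordination formula cancels the symbol of $(-\Delta)^{s/2}$, and every exchange
  of integrals is controlled by the integrability of $\hat g$ or of $|y|^s\hat g$. The time
  integral is brought inside the space integral, where it produces the Riesz kernel, only after
  absolute values are taken, so that Tonelli's theorem justifies this last exchange.
\<close>

lemma norm_le_riesz_potential_frac_laplacian:
  fixes g :: "real^'n::finite \<Rightarrow> complex"
  assumes g: "g \<in> schwartz_space" and s: "0 < s"
  shows "ennreal (norm (g x)) \<le> (\<integral>\<^sup>+z. riesz_kernel s (x - z) * ennreal (norm (frac_laplacian (s / 2) g z)) \<partial>lborel)"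
proof -
  define h where "h y = complex_of_real ((2 * pi * norm y) powr s) * fourier g y" for y
  have h: "integrable lborel h"
    unfolding h_def using g s by (intro fourier_integrable_powr) auto
  have [measurable]: "h \<in> borel_measurable borel" using h by (auto simp: integrable_iff_bounded)
  let ?f = "frac_laplacian (s / 2) g"
  have f: "?f = inverse_fourier h"
    by (simp add: frac_laplacian_def fourier_multiplier_def h_def[abs_def])
  have [measurable]: "?f \<in> borel_measurable borel" unfolding f by measurable
  let ?w = "gamma_weight (s / 2)"
  let ?G = "\<lambda>t y. exp (- (4 * pi\<^sup>2 * t * (norm y)\<^sup>2))"
  let ?P = "\<lambda>y t. complex_of_real (?w t * ?G t y) * (phase_inv x y * h y)"
  have w: "0 \<le> ?w t" for t using s by simp
  have "g x = (LINT y|lborel. phase_inv x y * fourier g y)"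
    using fourier_inversion[OF g, of x] by (simp add: inverse_fourier_def)
  also have "\<dots> = (LINT y|lborel. LINT t|lborel. ?P y t)"
  proof (rule integral_cong_AE)
    show "AE y in lborel. phase_inv x y * fourier g y = (LINT t|lborel. ?P y t)"
      using AE_lborel_nonzero
    proof eventually_elim
      fix y :: "real^'n" assume y: "y \<noteq> 0"
      have "(LINT t|lborel. ?P y t) = (LINT t|lborel. complex_of_real (?w t * ?G t y)) * (phase_inv x y * h y)"
        by (rule integral_mult_left_zero)
      also have "(LINT t|lborel. complex_of_real (?w t * ?G t y)) = of_real ((2 * pi * norm y) powr (- s))"
        unfolding integral_complex_of_real
        by (subst integral_eq_nn_integral) (auto simp: w heat_subordination[OF s y] intro!: AE_I2 mult_nonneg_nonneg)
      also have "of_real ((2 * pi * norm y) powr (- s)) * (phase_inv x y * h y)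
          = of_real ((2 * pi * norm y) powr (- s) * (2 * pi * norm y) powr s) * (phase_inv x y * fourier g y)"
        by (simp only: h_def of_real_mult mult_ac)
      also have "\<dots> = phase_inv x y * fourier g y"
        using y by (simp add: powr_add[symmetric] del: of_real_mult)
      finally show "phase_inv x y * fourier g y = (LINT t|lborel. ?P y t)" ..
    qed
    show "(\<lambda>y. phase_inv x y * fourier g y) \<in> borel_measurable lborel"
      using measurable_fourier[OF schwartz_measurable[OF g]] by measurable
  qed measurable
  also have "\<dots> = (LINT t|lborel. LINT y|lborel. ?P y t)"
  proof (rule Fubini_lborel)
    have "(\<integral>\<^sup>+y. (\<integral>\<^sup>+t. ennreal (norm (?P y t)) \<partial>lborel) \<partial>lborel) = (\<integral>\<^sup>+y. ennreal (norm (fourier g y)) \<partial>lborel)"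
    proof (rule nn_integral_cong_AE, use AE_lborel_nonzero in eventually_elim)
      fix y :: "real^'n" assume y: "y \<noteq> 0"
      have "(\<integral>\<^sup>+t. ennreal (norm (?P y t)) \<partial>lborel) = (\<integral>\<^sup>+t. ennreal (?w t * ?G t y) * ennreal (norm (h y)) \<partial>lborel)"
        by (simp add: norm_mult w ennreal_mult)
      also have "\<dots> = ennreal ((2 * pi * norm y) powr (- s)) * ennreal (norm (h y))"
        by (subst nn_integral_multc) (simp_all add: heat_subordination[OF s y])
      also have "\<dots> = ennreal ((2 * pi * norm y) powr (- s) * (2 * pi * norm y) powr s * norm (fourier g y))"
        by (simp add: ennreal_mult'[symmetric] h_def norm_mult mult.assoc)
      also have "\<dots> = ennreal (norm (fourier g y))"
        using y by (simp add: powr_add[symmetric])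
      finally show "(\<integral>\<^sup>+t. ennreal (norm (?P y t)) \<partial>lborel) = ennreal (norm (fourier g y))" .
    qed
    also have "\<dots> < \<infinity>" using fourier_integrable[OF g] by (simp add: integrable_iff_bounded)
    finally show "(\<integral>\<^sup>+y. (\<integral>\<^sup>+t. ennreal (norm (?P y t)) \<partial>lborel) \<partial>lborel) < \<infinity>" .
  qed measurable
  also have "\<dots> = (LINT t|lborel. of_real (?w t) * (LINT z|lborel. of_real (heat_kernel t (x - z)) * ?f z))"
  proof (intro Bochner_Integration.integral_cong refl)
    fix t :: real
    show "(LINT y|lborel. ?P y t) = of_real (?w t) * (LINT z|lborel. of_real (heat_kernel t (x - z)) * ?f z)"
    proof (cases "0 < t")
      case True
      have "(LINT y|lborel. ?P y t) = (LINT y|lborel. of_real (?w t) * (of_real (?G t y) * (phase_inv x y * h y)))"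
        by (simp only: of_real_mult mult.assoc)
      also have "\<dots> = of_real (?w t) * (LINT y|lborel. of_real (?G t y) * (phase_inv x y * h y))"
        by (rule integral_mult_right_zero)
      also have "(LINT y|lborel. of_real (?G t y) * (phase_inv x y * h y)) = (LINT z|lborel. of_real (heat_kernel t (x - z)) * ?f z)"
        unfolding f by (rule heat_kernel_convolution_inverse_fourier[OF True h, symmetric])
      finally show ?thesis .
    qed (simp add: gamma_weight_def)
  qed
  finally have "ennreal (norm (g x)) = ennreal (norm (LINT t|lborel. of_real (?w t) * (LINT z|lborel. of_real (heat_kernel t (x - z)) * ?f z)))"
    by simp
  also have "\<dots> \<le> (\<integral>\<^sup>+t. ennreal (norm (of_real (?w t) * (LINT z|lborel. of_real (heat_kernel t (x - z)) * ?f z))) \<partial>lborel)"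
    by (rule ennreal_norm_integral_le)
  also have "\<dots> \<le> (\<integral>\<^sup>+t. (\<integral>\<^sup>+z. ennreal (?w t * heat_kernel t (x - z)) * ennreal (norm (?f z)) \<partial>lborel) \<partial>lborel)"
  proof (rule nn_integral_mono)
    fix t :: real
    have "ennreal (norm (of_real (?w t) * (LINT z|lborel. of_real (heat_kernel t (x - z)) * ?f z)))
       = ennreal (?w t) * ennreal (norm (LINT z|lborel. of_real (heat_kernel t (x - z)) * ?f z))"
      using w by (simp add: norm_mult ennreal_mult)
    also have "\<dots> \<le> ennreal (?w t) * (\<integral>\<^sup>+z. ennreal (norm (of_real (heat_kernel t (x - z)) * ?f z)) \<partial>lborel)"
      by (intro mult_left_mono ennreal_norm_integral_le) simp
    also have "\<dots> = (\<integral>\<^sup>+z. ennreal (?w t * heat_kernel t (x - z)) * ennreal (norm (?f z)) \<partial>lborel)"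
      using w by (subst nn_integral_cmult[symmetric]) (auto simp: norm_mult ennreal_mult mult.assoc)
    finally show "ennreal (norm (of_real (?w t) * (LINT z|lborel. of_real (heat_kernel t (x - z)) * ?f z)))
      \<le> (\<integral>\<^sup>+z. ennreal (?w t * heat_kernel t (x - z)) * ennreal (norm (?f z)) \<partial>lborel)" .
  qed
  also have "\<dots> = (\<integral>\<^sup>+z. (\<integral>\<^sup>+t. ennreal (?w t * heat_kernel t (x - z)) * ennreal (norm (?f z)) \<partial>lborel) \<partial>lborel)"
    by (rule lborel_pair.Fubini') measurable
  also have "\<dots> = (\<integral>\<^sup>+z. riesz_kernel s (x - z) * ennreal (norm (?f z)) \<partial>lborel)"
    by (simp add: riesz_kernel_def nn_integral_multc)
  finally show ?thesis .
qed

section \<open>The weighted inequality\<close>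

lemma Lp_norm_le_from_nn_integral:
  fixes F G :: "real^'n::finite \<Rightarrow> complex"
  assumes c: "0 < c" and p: "0 < p"
    and le: "(\<integral>\<^sup>+x. ennreal (norm (F x) powr p) \<partial>lborel) \<le> ennreal (c powr p) * (\<integral>\<^sup>+x. ennreal (norm (G x) powr p) \<partial>lborel)"
  shows "Lp_norm p F \<le> ennreal c * Lp_norm p G"
proof (cases "(\<integral>\<^sup>+x. ennreal (norm (G x) powr p) \<partial>lborel)")
  case top
  then show ?thesis using c by (simp add: Lp_norm_def ennreal_mult_top)
next
  case (real j)
  with le c have "(\<integral>\<^sup>+x. ennreal (norm (F x) powr p) \<partial>lborel) \<le> ennreal (c powr p * j)"
    by (simp add: ennreal_mult)
  then obtain i where i: "(\<integral>\<^sup>+x. ennreal (norm (F x) powr p) \<partial>lborel) = ennreal i" "0 \<le> i" "i \<le> c powr p * j"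
    using real by (cases "(\<integral>\<^sup>+x. ennreal (norm (F x) powr p) \<partial>lborel)") (auto simp: top_unique)
  have "i powr (1 / p) \<le> (c powr p * j) powr (1 / p)"
    using i p by (intro powr_mono2) auto
  also have "\<dots> = c * j powr (1 / p)"
    using c p real by (simp add: powr_mult powr_powr)
  finally show ?thesis
    using real i c by (simp add: Lp_norm_def ennreal_mult'[symmetric])
qed

theorem corollary1:
  fixes p p' \<alpha> :: real and g :: "real^'n::finite \<Rightarrow> complex"
  assumes "1 < p" and "1 / p + 1 / p' = 1"
    and "0 \<le> \<alpha>" and "\<alpha> < real CARD('n)"
    and "g \<in> schwartz_space"
  shows "Lp_norm p (\<lambda>x. complex_of_real (norm x powr (- \<alpha> / p)) * g x)
    \<le> ennreal (2 powr (- \<alpha> / p) *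
        (Gamma ((real CARD('n) - \<alpha>) / (2 * p)) * Gamma (real CARD('n) / (2 * p'))
         / (Gamma (real CARD('n) / (2 * p') + \<alpha> / (2 * p)) * Gamma (real CARD('n) / (2 * p)))))
      * Lp_norm p (frac_laplacian (\<alpha> / (2 * p)) g)"
proof -
  define n where "n = real CARD('n)"
  define s where "s = \<alpha> / p"
  note p = assms(1) and g = assms(5)
  have n: "0 < n" by (simp add: n_def)
  have s: "0 \<le> s" "s < n / p" using assms by (auto simp: s_def n_def divide_strict_right_mono)
  have p': "1 / p' = 1 - 1 / p" using assms(2) by simp
  have np': "n / (2 * p') = (n - n / p) / 2"
  proof -
    have "n / (2 * p') = n / 2 * (1 / p')" by simp
    then show ?thesis unfolding p' by (simp add: field_simps)
  qed
  have const: "2 powr (- \<alpha> / p) * (Gamma ((n - \<alpha>) / (2 * p)) * Gamma (n / (2 * p'))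
         / (Gamma (n / (2 * p') + \<alpha> / (2 * p)) * Gamma (n / (2 * p)))) = stein_weiss_const n s p"
  proof -
    have "(n - \<alpha>) / (2 * p) = (n / p - s) / 2" "n / (2 * p) = n / p / 2"
      "n / (2 * p') + \<alpha> / (2 * p) = (n - n / p + s) / 2" "- \<alpha> / p = - s"
      by (simp_all add: np' s_def diff_divide_distrib add_divide_distrib)
    then show ?thesis unfolding stein_weiss_const_def np' by (simp only:)
  qed
  have C: "0 < stein_weiss_const n s p"
    using s p n by (rule stein_weiss_const_pos)
  have r: "\<alpha> / (2 * p) = s / 2" and s': "- \<alpha> / p = - s" by (simp_all add: s_def)
  have "(\<integral>\<^sup>+x. ennreal (norm (complex_of_real (norm x powr (- s)) * g x) powr p) \<partial>lborel)
     \<le> ennreal (stein_weiss_const n s p powr p) * (\<integral>\<^sup>+x. ennreal (norm (frac_laplacian (s / 2) g x) powr p) \<partial>lborel)"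
  proof (cases "s = 0")
    case True
    have np: "n / p < n" using p n by (simp add: divide_simps)
    have G: "Gamma (n / p / 2) \<noteq> 0" "Gamma ((n - n / p) / 2) \<noteq> 0"
      using p n np by (auto intro!: Gamma_real_pos[THEN less_imp_neq, symmetric])
    have 1: "stein_weiss_const n s p = 1"
      unfolding stein_weiss_const_def using G True by simp
    have "frac_laplacian (s / 2) g x = g x" for x
    proof -
      have "frac_laplacian (s / 2) g x = inverse_fourier (fourier g) x"
        unfolding frac_laplacian_def fourier_multiplier_def inverse_fourier_def
        \<comment> \<open>The symbol is $1$ except at the origin, where \<open>0 powr 0 = 0\<close>.\<close>
      proof (rule integral_cong_AE)
        show "AE y in lborel. phase_inv x y * (complex_of_real ((2 * pi * norm y) powr (2 * (s / 2))) * fourier g y)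
          = phase_inv x y * fourier g y"
          using AE_lborel_nonzero by eventually_elim (simp add: True)
      qed (use measurable_fourier[OF schwartz_measurable[OF g]] in measurable)
      then show ?thesis using fourier_inversion[OF g] by simp
    qed
    then show ?thesis
      using 1 p by (auto simp: True norm_mult powr_mult intro!: nn_integral_mono)
  next
    case False
    with s have spos: "0 < s" by simp
    have [measurable]: "g \<in> borel_measurable borel" by (rule schwartz_measurable[OF g])
    have [measurable]: "frac_laplacian (s / 2) g \<in> borel_measurable borel"
      unfolding frac_laplacian_def fourier_multiplier_def
      using measurable_fourier[OF schwartz_measurable[OF g]] by (intro measurable_inverse_fourier) measurable
    have "(\<integral>\<^sup>+x. ennreal ((norm x powr (- s) * norm (g x)) powr p) \<partial>lborel)
      \<le> ennreal (stein_weiss_const DIM(real^'n) s p powr p) * (\<integral>\<^sup>+y. ennreal (norm (frac_laplacian (s / 2) g y) powr p) \<partial>lborel)"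
      by (rule stein_weiss_inequality[OF p spos _ _ _ _ _ norm_le_riesz_potential_frac_laplacian[OF g spos]])
         (use s in \<open>simp_all add: n_def\<close>)
    then show ?thesis by (simp add: norm_mult n_def)
  qed
  then have "Lp_norm p (\<lambda>x. complex_of_real (norm x powr (- s)) * g x)
      \<le> ennreal (stein_weiss_const n s p) * Lp_norm p (frac_laplacian (s / 2) g)"
    using p by (intro Lp_norm_le_from_nn_integral C) auto
  then show ?thesis
    unfolding n_def[symmetric] unfolding const unfolding r s' .
qed

end
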